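(* Let $K$ be a field, $\Lambda$ a $k$-graph, and let $(\Delta,\alpha)$ and $(\Sigma,\beta)$ be irreducible representation $k$-graphs for $\Lambda$. Then $(\Delta,\alpha)\cong(\Sigma,\beta)$ in $\mathbf{RG}(\Lambda)$ if and only if $V_{(\Delta,\alpha)}\cong V_{(\Sigma,\beta)}$ as left $\mathrm{KP}(\Lambda)$-modules.
   Context: **$k$-graphs.** $\mathbb N=\{0,1,2,\dots\}$; for a positive integer $k$ the additive monoid $\mathbb N^k$ is viewed as a category with one object. A $k$-graph is a small category $\Lambda$ (the symbol $\Lambda$ also denotes its set of morphisms, $\Lambda^{\mathrm{ob}}$ its set of objects or vertices, $r,s$ the range and source maps) together with a functor $d:\Lambda\to\mathbb N^k$ (degree map) such that: if $d(\lambda)=m+n$ with $m,n\in\mathbb N^k$, there are unique $\mu,\nu\in\Lambda$ with $d(\mu)=m$, $d(\nu)=n$, $\lambda=\mu\circ\nu$. For $u,v\in\Lambda^{\mathrm{ob}}$, $n\in\mathbb N^k$: $u\Lambda=r^{-1}(u)$, $\Lambda v=s^{-1}(v)$, $u\Lambda v=u\Lambda\cap\Lambda v$, $u\Lambda^n=u\Lambda\cap d^{-1}(n)$. A morphism of $k$-graphs is a degree-preserving functor. Standing assumption: all $k$-graphs are nonempty ($\Lambda^{\mathrm{ob}}\ne\emptyset$), connected (the equivalence relation on $\Lambda^{\mathrm{ob}}$ generated by $\{(u,v): u\Lambda v\neq\emptyset\}$ is all of $\Lambda^{\mathrm{ob}}\times\Lambda^{\mathrm{ob}}$), row-finite (each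 $v\Lambda^n$ is finite) and without sources (each $v\Lambda^n$ is nonempty). **Walks.** Let $E_d$ be the directed graph with vertex set $\Lambda^{\mathrm{ob}}$, with one edge from $s(\lambda)$ to $r(\lambda)$ for each morphism $\lambda$ (identities included) and, for each non-identity $\lambda$, an extra edge $\lambda^*$ from $r(\lambda)$ to $s(\lambda)$. A walk in $\Lambda$ is a nonempty finite path $p=e_n\cdots e_1$ in $E_d$ ($s(e_i)=r(e_{i-1})$), with $s(p)=s(e_1)$, $r(p)=r(e_n)$. $\mathrm{Walk}_u(\Lambda)$ denotes the set of walks starting in $u$. A $k$-graph morphism $\alpha$ induces a map on walks (with $\lambda^*\mapsto\alpha(\lambda)^*$), again denoted $\alpha$. **Representation $k$-graphs.** A representation $k$-graph for $\Lambda$ is a pair $(\Delta,\alpha)$ of a $k$-graph $\Delta$ and a $k$-graph morphism $\alpha:\Delta\to\Lambda$ such that for every $v\in\Delta^{\mathrm{ob}}$: (i) $\alpha$ maps $\Delta v$ bijectively onto $\Lambda\alpha(v)$; (ii) $v\Delta^n$ is a singleton for every $n\in\mathbb N^k$. A morphism $(\Delta,\alpha)\to(\Sigma,\beta)$ is a $k$-graph morphism $\phi:\Delta\to\Sigma$ with $\beta\circ\phi=\alpha$. This gives the category $\mathbf{RG}(\Lambda)$. $(\Delta,\alpha)$ is irreducible if $\alpha(\mathrm{Walk}_u(\Delta))\neq\alpha(\mathrm{Walk}_v(\Delta))$ for all $u\neq v$ in $\Delta^{\mathrm{ob}}$. **Kumjian-Pask algebra.** $K$-algebras are associative, not necessarily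 commutative or unital. For $\lambda\in\Lambda$ of nonzero degree let $\lambda^*$ be a new symbol; for $\lambda$ of degree $0$ put $\lambda^*:=\lambda$. $\mathrm{KP}(\Lambda)$ is the $K$-algebra presented by generators $\Lambda\cup\Lambda^*$ and relations: (KP1) $\lambda\mu=\delta_{s(\lambda),r(\mu)}(\lambda\circ\mu)$ for $\lambda,\mu\in\Lambda$; (KP2) $\mu^*\lambda^*=\delta_{s(\lambda),r(\mu)}(\lambda\circ\mu)^*$ for $\lambda,\mu\in\Lambda$; (KP3) $\lambda^*\mu=\delta_{\lambda,\mu}1_{s(\lambda)}$ for $\lambda,\mu\in\Lambda$ with $d(\lambda)=d(\mu)$; (KP4) $\sum_{\lambda\in v\Lambda^n}\lambda\lambda^*=1_v$ for $v\in\Lambda^{\mathrm{ob}}$, $n\in\mathbb N^k$. **The module $V_{(\Delta,\alpha)}$.** It is the $K$-vector space with basis $\Delta^{\mathrm{ob}}$, with the left $\mathrm{KP}(\Lambda)$-action determined, for $\lambda\in\Lambda$ and $v\in\Delta^{\mathrm{ob}}$, by: $\lambda.v=r(\delta)$ if there is a (necessarily unique) $\delta\in\Delta v$ with $\alpha(\delta)=\lambda$, and $\lambda.v=0$ otherwise; $\lambda^*.v=s(\delta)$ if there is a (necessarily unique) $\delta\in v\Delta$ with $\alpha(\delta)=\lambda$, and $\lambda^*.v=0$ otherwise. *)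

theory Defs
  imports
    "HOL-Analysis.Finite_Cartesian_Product"
    "HOL-Library.Poly_Mapping"
begin

section \<open>Higher-rank graphs\<close>

text \<open>The rank of a graph is the cardinality of the finite type \<open>'k\<close>, which is automatically
  positive, and \<open>nat ^ 'k\<close> is the degree monoid. Composition is meaningful only for
  \<open>Src f = Rng g\<close>.\<close>

record ('o, 'm, 'k) kgraph =
  Obj :: "'o set"
  Mor :: "'m set"
  Src :: "'m \<Rightarrow> 'o"
  Rng :: "'m \<Rightarrow> 'o"
  Ident :: "'o \<Rightarrow> 'm"
  Comp :: "'m \<Rightarrow> 'm \<Rightarrow> 'm"
  Deg :: "'m \<Rightarrow> nat ^ 'k::finite"

locale small_category =
  fixes \<Lambda> :: "('o, 'm, 'k::finite) kgraph"
  assumes Src_in: "f \<in> Mor \<Lambda> \<Longrightarrow> Src \<Lambda> f \<in> Obj \<Lambda>"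
    and Rng_in: "f \<in> Mor \<Lambda> \<Longrightarrow> Rng \<Lambda> f \<in> Obj \<Lambda>"
    and Ident_in: "v \<in> Obj \<Lambda> \<Longrightarrow> Ident \<Lambda> v \<in> Mor \<Lambda>"
    and Src_Ident: "v \<in> Obj \<Lambda> \<Longrightarrow> Src \<Lambda> (Ident \<Lambda> v) = v"
    and Rng_Ident: "v \<in> Obj \<Lambda> \<Longrightarrow> Rng \<Lambda> (Ident \<Lambda> v) = v"
    and Comp_in: "\<lbrakk>f \<in> Mor \<Lambda>; g \<in> Mor \<Lambda>; Src \<Lambda> f = Rng \<Lambda> g\<rbrakk> \<Longrightarrow> Comp \<Lambda> f g \<in> Mor \<Lambda>"
    and Src_Comp: "\<lbrakk>f \<in> Mor \<Lambda>; g \<in> Mor \<Lambda>; Src \<Lambda> f = Rng \<Lambda> g\<rbrakk> \<Longrightarrow> Src \<Lambda> (Comp \<Lambda> f g) = Src \<Lambda> g"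
    and Rng_Comp: "\<lbrakk>f \<in> Mor \<Lambda>; g \<in> Mor \<Lambda>; Src \<Lambda> f = Rng \<Lambda> g\<rbrakk> \<Longrightarrow> Rng \<Lambda> (Comp \<Lambda> f g) = Rng \<Lambda> f"
    and Comp_Ident_left: "f \<in> Mor \<Lambda> \<Longrightarrow> Comp \<Lambda> (Ident \<Lambda> (Rng \<Lambda> f)) f = f"
    and Comp_Ident_right: "f \<in> Mor \<Lambda> \<Longrightarrow> Comp \<Lambda> f (Ident \<Lambda> (Src \<Lambda> f)) = f"
    and Comp_assoc:
      "\<lbrakk>f \<in> Mor \<Lambda>; g \<in> Mor \<Lambda>; h \<in> Mor \<Lambda>; Src \<Lambda> f = Rng \<Lambda> g; Src \<Lambda> g = Rng \<Lambda> h\<rbrakk>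
       \<Longrightarrow> Comp \<Lambda> (Comp \<Lambda> f g) h = Comp \<Lambda> f (Comp \<Lambda> g h)"

locale k_graph = small_category \<Lambda> for \<Lambda> :: "('o, 'm, 'k::finite) kgraph" +
  assumes Deg_Ident: "v \<in> Obj \<Lambda> \<Longrightarrow> Deg \<Lambda> (Ident \<Lambda> v) = 0"
    and Deg_Comp:
      "\<lbrakk>f \<in> Mor \<Lambda>; g \<in> Mor \<Lambda>; Src \<Lambda> f = Rng \<Lambda> g\<rbrakk> \<Longrightarrow> Deg \<Lambda> (Comp \<Lambda> f g) = Deg \<Lambda> f + Deg \<Lambda> g"
    and unique_factorization:
      "\<lbrakk>f \<in> Mor \<Lambda>; Deg \<Lambda> f = m + n\<rbrakk> \<Longrightarrow>
       \<exists>!(g, h). g \<in> Mor \<Lambda> \<and> h \<in> Mor \<Lambda> \<and> Src \<Lambda> g = Rng \<Lambda> h \<and>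
                 Deg \<Lambda> g = m \<and> Deg \<Lambda> h = n \<and> f = Comp \<Lambda> g h"

text \<open>The sets \<open>u\<Lambda>\<close>, \<open>\<Lambda>v\<close> and \<open>u\<Lambda>\<^sup>n\<close>.\<close>

definition into :: "('o, 'm, 'k::finite) kgraph \<Rightarrow> 'o \<Rightarrow> 'm set" where
  "into \<Lambda> u = {f \<in> Mor \<Lambda>. Rng \<Lambda> f = u}"

definition out_of :: "('o, 'm, 'k::finite) kgraph \<Rightarrow> 'o \<Rightarrow> 'm set" where
  "out_of \<Lambda> v = {f \<in> Mor \<Lambda>. Src \<Lambda> f = v}"

definition into_deg :: "('o, 'm, 'k::finite) kgraph \<Rightarrow> 'o \<Rightarrow> nat ^ 'k \<Rightarrow> 'm set" where
  "into_deg \<Lambda> u n = {f \<in> into \<Lambda> u. Deg \<Lambda> f = n}"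

definition linked :: "('o, 'm, 'k::finite) kgraph \<Rightarrow> 'o rel" where
  "linked \<Lambda> = {(u, v). u \<in> Obj \<Lambda> \<and> v \<in> Obj \<Lambda> \<and> into \<Lambda> u \<inter> out_of \<Lambda> v \<noteq> {}}"

locale standing_k_graph = k_graph \<Lambda> for \<Lambda> :: "('o, 'm, 'k::finite) kgraph" +
  assumes Obj_nonempty: "Obj \<Lambda> \<noteq> {}"
    and connected: "\<lbrakk>u \<in> Obj \<Lambda>; v \<in> Obj \<Lambda>\<rbrakk> \<Longrightarrow> (u, v) \<in> (linked \<Lambda> \<union> (linked \<Lambda>)\<inverse>)\<^sup>*"
    and row_finite: "v \<in> Obj \<Lambda> \<Longrightarrow> finite (into_deg \<Lambda> v n)"
    and no_sources: "v \<in> Obj \<Lambda> \<Longrightarrow> into_deg \<Lambda> v n \<noteq> {}"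

record ('o, 'm, 'p, 'q) kmap =
  on_obj :: "'o \<Rightarrow> 'p"
  on_mor :: "'m \<Rightarrow> 'q"

locale k_graph_morphism =
  fixes \<Delta> :: "('o, 'm, 'k::finite) kgraph" and \<Lambda> :: "('p, 'q, 'k) kgraph"
    and \<alpha> :: "('o, 'm, 'p, 'q) kmap"
  assumes obj_in: "v \<in> Obj \<Delta> \<Longrightarrow> on_obj \<alpha> v \<in> Obj \<Lambda>"
    and mor_in: "f \<in> Mor \<Delta> \<Longrightarrow> on_mor \<alpha> f \<in> Mor \<Lambda>"
    and map_Src: "f \<in> Mor \<Delta> \<Longrightarrow> Src \<Lambda> (on_mor \<alpha> f) = on_obj \<alpha> (Src \<Delta> f)"
    and map_Rng: "f \<in> Mor \<Delta> \<Longrightarrow> Rng \<Lambda> (on_mor \<alpha> f) = on_obj \<alpha> (Rng \<Delta> f)"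
    and map_Ident: "v \<in> Obj \<Delta> \<Longrightarrow> on_mor \<alpha> (Ident \<Delta> v) = Ident \<Lambda> (on_obj \<alpha> v)"
    and map_Comp: "\<lbrakk>f \<in> Mor \<Delta>; g \<in> Mor \<Delta>; Src \<Delta> f = Rng \<Delta> g\<rbrakk> \<Longrightarrow>
       on_mor \<alpha> (Comp \<Delta> f g) = Comp \<Lambda> (on_mor \<alpha> f) (on_mor \<alpha> g)"
    and map_Deg: "f \<in> Mor \<Delta> \<Longrightarrow> Deg \<Lambda> (on_mor \<alpha> f) = Deg \<Delta> f"


section \<open>Walks\<close>

text \<open>\<open>Arr f\<close> stands for \<open>f\<close> and \<open>Star f\<close> for the formal symbol \<open>f\<^sup>*\<close>. Letters serve both as edges
  of the graph in which walks live and as generators of the Kumjian-Pask algebra.\<close>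

datatype 'm letter = Arr 'm | Star 'm

definition edges :: "('o, 'm, 'k::finite) kgraph \<Rightarrow> 'm letter set" where
  "edges \<Lambda> = Arr ` Mor \<Lambda> \<union> Star ` (Mor \<Lambda> - Ident \<Lambda> ` Obj \<Lambda>)"

fun edge_src :: "('o, 'm, 'k::finite) kgraph \<Rightarrow> 'm letter \<Rightarrow> 'o" where
  "edge_src \<Lambda> (Arr f) = Src \<Lambda> f"
| "edge_src \<Lambda> (Star f) = Rng \<Lambda> f"

fun edge_rng :: "('o, 'm, 'k::finite) kgraph \<Rightarrow> 'm letter \<Rightarrow> 'o" where
  "edge_rng \<Lambda> (Arr f) = Rng \<Lambda> f"
| "edge_rng \<Lambda> (Star f) = Src \<Lambda> f"

text \<open>The walk \<open>e\<^sub>n \<dots> e\<^sub>1\<close> is the list \<open>[e\<^sub>n, \<dots>, e\<^sub>1]\<close>, so it starts at the source of its last entry.\<close>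

definition walks :: "('o, 'm, 'k::finite) kgraph \<Rightarrow> 'm letter list set" where
  "walks \<Lambda> = {p. p \<noteq> [] \<and> set p \<subseteq> edges \<Lambda> \<and>
                  successively (\<lambda>e f. edge_src \<Lambda> e = edge_rng \<Lambda> f) p}"

definition walks_from :: "('o, 'm, 'k::finite) kgraph \<Rightarrow> 'o \<Rightarrow> 'm letter list set" where
  "walks_from \<Lambda> u = {p \<in> walks \<Lambda>. edge_src \<Lambda> (last p) = u}"

definition map_walk :: "('o, 'm, 'p, 'q) kmap \<Rightarrow> 'm letter list \<Rightarrow> 'q letter list" where
  "map_walk \<alpha> = map (map_letter (on_mor \<alpha>))"


section \<open>Representation graphs\<close>

locale rep_k_graph =
  k_graph_morphism \<Delta> \<Lambda> \<alpha> + base: standing_k_graph \<Lambda> + total: standing_k_graph \<Delta>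
  for \<Lambda> :: "('p, 'q, 'k::finite) kgraph" and \<Delta> :: "('o, 'm, 'k) kgraph"
    and \<alpha> :: "('o, 'm, 'p, 'q) kmap" +
  assumes bij_out_of: "v \<in> Obj \<Delta> \<Longrightarrow> bij_betw (on_mor \<alpha>) (out_of \<Delta> v) (out_of \<Lambda> (on_obj \<alpha> v))"
    and into_deg_singleton: "v \<in> Obj \<Delta> \<Longrightarrow> \<exists>f. into_deg \<Delta> v n = {f}"

definition rg_irreducible ::
  "('o, 'm, 'k::finite) kgraph \<Rightarrow> ('o, 'm, 'p, 'q) kmap \<Rightarrow> bool" where
  "rg_irreducible \<Delta> \<alpha> \<longleftrightarrow>
     (\<forall>u\<in>Obj \<Delta>. \<forall>v\<in>Obj \<Delta>. u \<noteq> v \<longrightarrow> map_walk \<alpha> ` walks_from \<Delta> u \<noteq> map_walk \<alpha> ` walks_from \<Delta> v)"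

definition rg_morphism ::
  "('o, 'm, 'k::finite) kgraph \<Rightarrow> ('o, 'm, 'p, 'q) kmap \<Rightarrow>
   ('s, 't, 'k) kgraph \<Rightarrow> ('s, 't, 'p, 'q) kmap \<Rightarrow> ('o, 'm, 's, 't) kmap \<Rightarrow> bool" where
  "rg_morphism \<Delta> \<alpha> \<Sigma> \<beta> \<phi> \<longleftrightarrow> k_graph_morphism \<Delta> \<Sigma> \<phi> \<and>
     (\<forall>v\<in>Obj \<Delta>. on_obj \<beta> (on_obj \<phi> v) = on_obj \<alpha> v) \<and>
     (\<forall>f\<in>Mor \<Delta>. on_mor \<beta> (on_mor \<phi> f) = on_mor \<alpha> f)"

text \<open>Maps are total functions, so equations between morphisms are required on the carriers only.\<close>

definition rg_isomorphic ::
  "('o, 'm, 'k::finite) kgraph \<Rightarrow> ('o, 'm, 'p, 'q) kmap \<Rightarrow>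
   ('s, 't, 'k) kgraph \<Rightarrow> ('s, 't, 'p, 'q) kmap \<Rightarrow> bool" where
  "rg_isomorphic \<Delta> \<alpha> \<Sigma> \<beta> \<longleftrightarrow> (\<exists>\<phi> \<psi>. rg_morphism \<Delta> \<alpha> \<Sigma> \<beta> \<phi> \<and> rg_morphism \<Sigma> \<beta> \<Delta> \<alpha> \<psi> \<and>
     (\<forall>v\<in>Obj \<Delta>. on_obj \<psi> (on_obj \<phi> v) = v) \<and> (\<forall>f\<in>Mor \<Delta>. on_mor \<psi> (on_mor \<phi> f) = f) \<and>
     (\<forall>v\<in>Obj \<Sigma>. on_obj \<phi> (on_obj \<psi> v) = v) \<and> (\<forall>f\<in>Mor \<Sigma>. on_mor \<phi> (on_mor \<psi> f) = f))"


section \<open>Algebras without unit and their left modules\<close>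

record ('a, 'f) alg =
  acarrier :: "'a set"
  azero :: 'a
  aadd :: "'a \<Rightarrow> 'a \<Rightarrow> 'a"
  ascale :: "'f \<Rightarrow> 'a \<Rightarrow> 'a"
  amult :: "'a \<Rightarrow> 'a \<Rightarrow> 'a"

record ('v, 'f, 'a) lmod =
  mcarrier :: "'v set"
  mzero :: 'v
  madd :: "'v \<Rightarrow> 'v \<Rightarrow> 'v"
  mscale :: "'f \<Rightarrow> 'v \<Rightarrow> 'v"
  mact :: "'a \<Rightarrow> 'v \<Rightarrow> 'v"

locale vector_space_on =
  fixes C :: "'v set" and zero :: 'v and add :: "'v \<Rightarrow> 'v \<Rightarrow> 'v"
    and scale :: "'f::field \<Rightarrow> 'v \<Rightarrow> 'v"
  assumes zero_in: "zero \<in> C"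
    and add_in: "\<lbrakk>x \<in> C; y \<in> C\<rbrakk> \<Longrightarrow> add x y \<in> C"
    and scale_in: "x \<in> C \<Longrightarrow> scale c x \<in> C"
    and add_assoc: "\<lbrakk>x \<in> C; y \<in> C; z \<in> C\<rbrakk> \<Longrightarrow> add (add x y) z = add x (add y z)"
    and add_commute: "\<lbrakk>x \<in> C; y \<in> C\<rbrakk> \<Longrightarrow> add x y = add y x"
    and add_zero: "x \<in> C \<Longrightarrow> add zero x = x"
    and add_inverse: "x \<in> C \<Longrightarrow> \<exists>y\<in>C. add y x = zero"
    and scale_add_right: "\<lbrakk>x \<in> C; y \<in> C\<rbrakk> \<Longrightarrow> scale c (add x y) = add (scale c x) (scale c y)"
    and scale_add_left: "x \<in> C \<Longrightarrow> scale (c + d) x = add (scale c x) (scale d x)"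
    and scale_scale: "x \<in> C \<Longrightarrow> scale c (scale d x) = scale (c * d) x"
    and scale_one: "x \<in> C \<Longrightarrow> scale 1 x = x"

locale nonunital_algebra =
  vector_space_on "acarrier A" "azero A" "aadd A" "ascale A" for A :: "('a, 'f::field) alg" +
  assumes mult_in: "\<lbrakk>a \<in> acarrier A; b \<in> acarrier A\<rbrakk> \<Longrightarrow> amult A a b \<in> acarrier A"
    and mult_assoc: "\<lbrakk>a \<in> acarrier A; b \<in> acarrier A; c \<in> acarrier A\<rbrakk> \<Longrightarrow>
       amult A (amult A a b) c = amult A a (amult A b c)"
    and mult_add_left: "\<lbrakk>a \<in> acarrier A; b \<in> acarrier A; c \<in> acarrier A\<rbrakk> \<Longrightarrow>
       amult A (aadd A a b) c = aadd A (amult A a c) (amult A b c)"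
    and mult_add_right: "\<lbrakk>a \<in> acarrier A; b \<in> acarrier A; c \<in> acarrier A\<rbrakk> \<Longrightarrow>
       amult A a (aadd A b c) = aadd A (amult A a b) (amult A a c)"
    and mult_scale_left: "\<lbrakk>a \<in> acarrier A; b \<in> acarrier A\<rbrakk> \<Longrightarrow>
       amult A (ascale A t a) b = ascale A t (amult A a b)"
    and mult_scale_right: "\<lbrakk>a \<in> acarrier A; b \<in> acarrier A\<rbrakk> \<Longrightarrow>
       amult A a (ascale A t b) = ascale A t (amult A a b)"

locale left_module =
  A: nonunital_algebra A + vector_space_on "mcarrier M" "mzero M" "madd M" "mscale M"
  for A :: "('a, 'f::field) alg" and M :: "('v, 'f, 'a) lmod" +
  assumes act_in: "\<lbrakk>a \<in> acarrier A; x \<in> mcarrier M\<rbrakk> \<Longrightarrow> mact M a x \<in> mcarrier M"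
    and act_mult: "\<lbrakk>a \<in> acarrier A; b \<in> acarrier A; x \<in> mcarrier M\<rbrakk> \<Longrightarrow>
       mact M (amult A a b) x = mact M a (mact M b x)"
    and act_add_left: "\<lbrakk>a \<in> acarrier A; b \<in> acarrier A; x \<in> mcarrier M\<rbrakk> \<Longrightarrow>
       mact M (aadd A a b) x = madd M (mact M a x) (mact M b x)"
    and act_add_right: "\<lbrakk>a \<in> acarrier A; x \<in> mcarrier M; y \<in> mcarrier M\<rbrakk> \<Longrightarrow>
       mact M a (madd M x y) = madd M (mact M a x) (mact M a y)"
    and act_scale_left: "\<lbrakk>a \<in> acarrier A; x \<in> mcarrier M\<rbrakk> \<Longrightarrow>
       mact M (ascale A t a) x = mscale M t (mact M a x)"
    and act_scale_right: "\<lbrakk>a \<in> acarrier A; x \<in> mcarrier M\<rbrakk> \<Longrightarrow>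
       mact M a (mscale M t x) = mscale M t (mact M a x)"

definition module_hom ::
  "('a, 'f) alg \<Rightarrow> ('v, 'f, 'a) lmod \<Rightarrow> ('w, 'f, 'a) lmod \<Rightarrow> ('v \<Rightarrow> 'w) \<Rightarrow> bool" where
  "module_hom A M N h \<longleftrightarrow>
     (\<forall>x\<in>mcarrier M. h x \<in> mcarrier N) \<and>
     (\<forall>x\<in>mcarrier M. \<forall>y\<in>mcarrier M. h (madd M x y) = madd N (h x) (h y)) \<and>
     (\<forall>c. \<forall>x\<in>mcarrier M. h (mscale M c x) = mscale N c (h x)) \<and>
     (\<forall>a\<in>acarrier A. \<forall>x\<in>mcarrier M. h (mact M a x) = mact N a (h x))"

definition module_isomorphic ::
  "('a, 'f) alg \<Rightarrow> ('v, 'f, 'a) lmod \<Rightarrow> ('w, 'f, 'a) lmod \<Rightarrow> bool" where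
  "module_isomorphic A M N \<longleftrightarrow>
     (\<exists>h. module_hom A M N h \<and> bij_betw h (mcarrier M) (mcarrier N))"


section \<open>Free algebras\<close>

text \<open>Words form the free monoid, written additively so that \<open>'g word \<Rightarrow>\<^sub>0 'f\<close> with its
  convolution product is the free unital algebra on \<open>'g\<close>.\<close>

datatype 'g word = Word (letters: "'g list")

instantiation word :: (type) monoid_add
begin
definition zero_word :: "'a word" where "0 = Word []"
definition plus_word :: "'a word \<Rightarrow> 'a word \<Rightarrow> 'a word" where
  "u + v = Word (letters u @ letters v)"
instance by standard (simp_all add: zero_word_def plus_word_def)
end

definition smul :: "'f::field \<Rightarrow> ('x \<Rightarrow>\<^sub>0 'f) \<Rightarrow> ('x \<Rightarrow>\<^sub>0 'f)" where
  "smul c x = Poly_Mapping.map ((*) c) x"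

text \<open>The linear extension of a map defined on a basis.\<close>

definition lin :: "('x \<Rightarrow> ('y \<Rightarrow>\<^sub>0 'f::field)) \<Rightarrow> ('x \<Rightarrow>\<^sub>0 'f) \<Rightarrow> ('y \<Rightarrow>\<^sub>0 'f)" where
  "lin h x = (\<Sum>b\<in>Poly_Mapping.keys x. smul (Poly_Mapping.lookup x b) (h b))"

definition free_algebra :: "'g set \<Rightarrow> ('g word \<Rightarrow>\<^sub>0 'f::field) set" where
  "free_algebra G = {a. \<forall>w\<in>Poly_Mapping.keys a. letters w \<noteq> [] \<and> set (letters w) \<subseteq> G}"

definition gen :: "'g \<Rightarrow> ('g word \<Rightarrow>\<^sub>0 'f::field)" where
  "gen g = Poly_Mapping.single (Word [g]) 1"

text \<open>The two-sided ideal of the (non-unital) free algebra on \<open>G\<close> generated by \<open>R\<close>.\<close>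

inductive_set gen_ideal ::
  "'g set \<Rightarrow> ('g word \<Rightarrow>\<^sub>0 'f::field) set \<Rightarrow> ('g word \<Rightarrow>\<^sub>0 'f) set"
  for G :: "'g set" and R :: "('g word \<Rightarrow>\<^sub>0 'f::field) set" where
  relator: "a \<in> R \<Longrightarrow> a \<in> gen_ideal G R"
| zero: "0 \<in> gen_ideal G R"
| add: "\<lbrakk>a \<in> gen_ideal G R; b \<in> gen_ideal G R\<rbrakk> \<Longrightarrow> a + b \<in> gen_ideal G R"
| scale: "a \<in> gen_ideal G R \<Longrightarrow> smul c a \<in> gen_ideal G R"
| mult_left: "\<lbrakk>b \<in> free_algebra G; a \<in> gen_ideal G R\<rbrakk> \<Longrightarrow> b * a \<in> gen_ideal G R"
| mult_right: "\<lbrakk>a \<in> gen_ideal G R; b \<in> free_algebra G\<rbrakk> \<Longrightarrow> a * b \<in> gen_ideal G R"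

definition coset_of :: "'x set \<Rightarrow> 'x::plus \<Rightarrow> 'x set" where
  "coset_of I a = {a + i |i. i \<in> I}"

text \<open>The algebra presented by generators \<open>G\<close> and relators \<open>R\<close>; its elements are cosets.\<close>

definition presented_algebra ::
  "'g set \<Rightarrow> ('g word \<Rightarrow>\<^sub>0 'f::field) set \<Rightarrow> (('g word \<Rightarrow>\<^sub>0 'f) set, 'f) alg" where
  "presented_algebra G R = (let I = gen_ideal G R in
    \<lparr>acarrier = coset_of I ` free_algebra G,
     azero = I,
     aadd = (\<lambda>X Y. \<Union>x\<in>X. \<Union>y\<in>Y. coset_of I (x + y)),
     ascale = (\<lambda>c X. \<Union>x\<in>X. coset_of I (smul c x)),
     amult = (\<lambda>X Y. \<Union>x\<in>X. \<Union>y\<in>Y. coset_of I (x * y))\<rparr>)"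


section \<open>The Kumjian-Pask algebra\<close>

definition kp_letters :: "('o, 'm, 'k::finite) kgraph \<Rightarrow> 'm letter set" where
  "kp_letters \<Lambda> = Arr ` Mor \<Lambda> \<union> Star ` {f \<in> Mor \<Lambda>. Deg \<Lambda> f \<noteq> 0}"

definition star :: "('o, 'm, 'k::finite) kgraph \<Rightarrow> 'm \<Rightarrow> 'm letter" where
  "star \<Lambda> f = (if Deg \<Lambda> f = 0 then Arr f else Star f)"

inductive_set kp_relators ::
  "('o, 'm, 'k::finite) kgraph \<Rightarrow> ('m letter word \<Rightarrow>\<^sub>0 'f::field) set"
  for \<Lambda> :: "('o, 'm, 'k::finite) kgraph" where
  KP1: "\<lbrakk>f \<in> Mor \<Lambda>; g \<in> Mor \<Lambda>\<rbrakk> \<Longrightarrow>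
    gen (Arr f) * gen (Arr g) - (if Src \<Lambda> f = Rng \<Lambda> g then gen (Arr (Comp \<Lambda> f g)) else 0)
    \<in> kp_relators \<Lambda>"
| KP2: "\<lbrakk>f \<in> Mor \<Lambda>; g \<in> Mor \<Lambda>\<rbrakk> \<Longrightarrow>
    gen (star \<Lambda> g) * gen (star \<Lambda> f) -
      (if Src \<Lambda> f = Rng \<Lambda> g then gen (star \<Lambda> (Comp \<Lambda> f g)) else 0)
    \<in> kp_relators \<Lambda>"
| KP3: "\<lbrakk>f \<in> Mor \<Lambda>; g \<in> Mor \<Lambda>; Deg \<Lambda> f = Deg \<Lambda> g\<rbrakk> \<Longrightarrow>
    gen (star \<Lambda> f) * gen (Arr g) - (if f = g then gen (Arr (Ident \<Lambda> (Src \<Lambda> f))) else 0)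
    \<in> kp_relators \<Lambda>"
| KP4: "v \<in> Obj \<Lambda> \<Longrightarrow>
    (\<Sum>f\<in>into_deg \<Lambda> v n. gen (Arr f) * gen (star \<Lambda> f)) - gen (Arr (Ident \<Lambda> v))
    \<in> kp_relators \<Lambda>"

definition KP :: "'f itself \<Rightarrow> ('o, 'm, 'k::finite) kgraph \<Rightarrow>
    (('m letter word \<Rightarrow>\<^sub>0 'f::field) set, 'f) alg" where
  "KP _ \<Lambda> = presented_algebra (kp_letters \<Lambda>) (kp_relators \<Lambda>)"


section \<open>The module of a representation graph\<close>

fun act_basis :: "('o, 'm, 'k::finite) kgraph \<Rightarrow> ('o, 'm, 'p, 'q) kmap \<Rightarrow>
    'q letter \<Rightarrow> 'o \<Rightarrow> ('o \<Rightarrow>\<^sub>0 'f::field)" where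
  "act_basis \<Delta> \<alpha> (Arr l) v =
     (if \<exists>f\<in>out_of \<Delta> v. on_mor \<alpha> f = l
      then Poly_Mapping.single (Rng \<Delta> (THE f. f \<in> out_of \<Delta> v \<and> on_mor \<alpha> f = l)) 1 else 0)"
| "act_basis \<Delta> \<alpha> (Star l) v =
     (if \<exists>f\<in>into \<Delta> v. on_mor \<alpha> f = l
      then Poly_Mapping.single (Src \<Delta> (THE f. f \<in> into \<Delta> v \<and> on_mor \<alpha> f = l)) 1 else 0)"

definition act_word :: "('o, 'm, 'k::finite) kgraph \<Rightarrow> ('o, 'm, 'p, 'q) kmap \<Rightarrow>
    'q letter word \<Rightarrow> ('o \<Rightarrow>\<^sub>0 'f::field) \<Rightarrow> ('o \<Rightarrow>\<^sub>0 'f)" where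
  "act_word \<Delta> \<alpha> w x = foldr (\<lambda>g. lin (act_basis \<Delta> \<alpha> g)) (letters w) x"

definition act_free :: "('o, 'm, 'k::finite) kgraph \<Rightarrow> ('o, 'm, 'p, 'q) kmap \<Rightarrow>
    ('q letter word \<Rightarrow>\<^sub>0 'f::field) \<Rightarrow> ('o \<Rightarrow>\<^sub>0 'f) \<Rightarrow> ('o \<Rightarrow>\<^sub>0 'f)" where
  "act_free \<Delta> \<alpha> a x = lin (\<lambda>w. act_word \<Delta> \<alpha> w x) a"

text \<open>A coset acts as any of its representatives; that this is well defined is
  \<open>mact_rep_module\<close> below.\<close>

definition rep_module :: "('o, 'm, 'k::finite) kgraph \<Rightarrow> ('o, 'm, 'p, 'q) kmap \<Rightarrow>
    ('o \<Rightarrow>\<^sub>0 'f::field, 'f, ('q letter word \<Rightarrow>\<^sub>0 'f) set) lmod" where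
  "rep_module \<Delta> \<alpha> =
    \<lparr>mcarrier = {x. Poly_Mapping.keys x \<subseteq> Obj \<Delta>},
     mzero = 0,
     madd = (+),
     mscale = smul,
     mact = (\<lambda>X x. THE y. \<forall>a\<in>X. y = act_free \<Delta> \<alpha> a x)\<rparr>"


section \<open>The algebra and module laws\<close>

subsection \<open>Linear extension and presented algebras\<close>

lemma lookup_smul [simp]: "Poly_Mapping.lookup (smul c x) k = c * Poly_Mapping.lookup x k"
  by (simp add: smul_def Poly_Mapping.map.rep_eq when_def)

lemma smul_add_right: "smul c (x + y) = smul c x + smul c y"
  and smul_add_left: "smul (c + d) x = smul c x + smul d x"
  and smul_smul: "smul c (smul d x) = smul (c * d) x"
  and smul_one [simp]: "smul 1 x = x"
  and smul_zero_left [simp]: "smul 0 x = 0"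
  and smul_zero_right [simp]: "smul c 0 = 0"
  and smul_minus: "smul (- 1) x = - x"
  by (auto intro!: poly_mapping_eqI simp: lookup_add algebra_simps)

lemma smul_sum: "smul c (\<Sum>i\<in>S. f i) = (\<Sum>i\<in>S. smul c (f i))"
  by (induction S rule: infinite_finite_induct) (simp_all add: smul_add_right)

lemma smul_conv_mult: "smul c (a :: 'g word \<Rightarrow>\<^sub>0 'f::field) = Poly_Mapping.single 0 c * a"
  by (simp add: smul_def mult_map_scale_conv_mult)

lemma smul_mult_left: "smul c a * b = smul c (a * b)"
  for a :: "'g word \<Rightarrow>\<^sub>0 'f::field"
  by (simp add: smul_conv_mult mult.assoc)

lemma poly_mapping_expand:
  "x = (\<Sum>b\<in>Poly_Mapping.keys x. Poly_Mapping.single b (Poly_Mapping.lookup x b))"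
proof (rule poly_mapping_eqI)
  fix k
  have "(\<Sum>b\<in>Poly_Mapping.keys x. Poly_Mapping.lookup x b when b = k) = Poly_Mapping.lookup x k"
    by (simp add: when_def in_keys_iff)
  then show "Poly_Mapping.lookup x k =
      Poly_Mapping.lookup (\<Sum>b\<in>Poly_Mapping.keys x. Poly_Mapping.single b (Poly_Mapping.lookup x b)) k"
    by (simp add: lookup_sum lookup_single)
qed

lemma single_comm: "a * Poly_Mapping.single 0 c = Poly_Mapping.single 0 c * a"
  for a :: "'g word \<Rightarrow>\<^sub>0 'f::field"
proof -
  have "(\<Sum>b\<in>S. Poly_Mapping.single b (f b)) * Poly_Mapping.single 0 c =
      Poly_Mapping.single 0 c * (\<Sum>b\<in>S. Poly_Mapping.single b (f b))"
    for S :: "'g word set" and f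
    by (simp add: sum_distrib_left sum_distrib_right mult_single mult.commute)
  from this[where S = "Poly_Mapping.keys a" and f = "Poly_Mapping.lookup a"]
  show ?thesis
    by (simp only: poly_mapping_expand[symmetric])
qed

lemma smul_mult_right: "a * smul c b = smul c (a * b)"
  for a :: "'g word \<Rightarrow>\<^sub>0 'f::field"
  by (metis single_comm mult.assoc smul_conv_mult)

lemma keys_smul: "Poly_Mapping.keys (smul c x) \<subseteq> Poly_Mapping.keys x"
  by (auto simp: in_keys_iff)

lemma lin_superset:
  assumes "finite S" "Poly_Mapping.keys x \<subseteq> S"
  shows "lin h x = (\<Sum>b\<in>S. smul (Poly_Mapping.lookup x b) (h b))"
  unfolding lin_def using assms
  by (intro sum.mono_neutral_left) (auto simp: in_keys_iff)

lemma lin_add: "lin h (x + y) = lin h x + lin h y"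
proof -
  let ?S = "Poly_Mapping.keys x \<union> Poly_Mapping.keys y"
  have "lin h (x + y) = (\<Sum>b\<in>?S. smul (Poly_Mapping.lookup (x + y) b) (h b))"
    by (rule lin_superset) (use keys_add[of x y] in auto)
  also have "\<dots> = (\<Sum>b\<in>?S. smul (Poly_Mapping.lookup x b) (h b)) + (\<Sum>b\<in>?S. smul (Poly_Mapping.lookup y b) (h b))"
    by (simp add: lookup_add smul_add_left sum.distrib)
  also have "\<dots> = lin h x + lin h y"
    by (simp add: lin_superset[of ?S x] lin_superset[of ?S y])
  finally show ?thesis .
qed

lemma lin_smul: "lin h (smul c x) = smul c (lin h x)"
  by (subst lin_superset[OF _ keys_smul]) (simp_all add: lin_def smul_sum smul_smul)

lemma lin_zero [simp]: "lin h 0 = 0"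
  by (simp add: lin_def)

lemma lin_single: "lin h (Poly_Mapping.single b c) = smul c (h b)"
  by (simp add: lin_def)

lemma lin_uminus: "lin h (- x) = - lin h x"
  using lin_smul[of h "-1" x] by (simp add: smul_minus)

lemma lin_diff: "lin h (x - y) = lin h x - lin h y"
  using lin_add[of h x "- y"] by (simp add: lin_uminus)

lemma lin_sum: "lin h (\<Sum>i\<in>S. f i) = (\<Sum>i\<in>S. lin h (f i))"
  by (induction S rule: infinite_finite_induct) (simp_all add: lin_add)

lemma lin_add_fun: "lin (\<lambda>b. h b + k b) x = lin h x + lin k x"
  by (simp add: lin_def smul_add_right sum.distrib)

lemma lin_smul_fun: "lin (\<lambda>b. smul c (h b)) x = smul c (lin h x)"
  by (simp add: lin_def smul_sum smul_smul mult.commute)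

lemma lin_cong: "(\<And>b. b \<in> Poly_Mapping.keys x \<Longrightarrow> h b = k b) \<Longrightarrow> lin h x = lin k x"
  by (simp add: lin_def)

lemma lin_keys:
  assumes "\<And>b. b \<in> Poly_Mapping.keys x \<Longrightarrow> Poly_Mapping.keys (h b) \<subseteq> C"
  shows "Poly_Mapping.keys (lin h x) \<subseteq> C"
proof
  fix k assume "k \<in> Poly_Mapping.keys (lin h x)"
  then have "(\<Sum>b\<in>Poly_Mapping.keys x. Poly_Mapping.lookup x b * Poly_Mapping.lookup (h b) k) \<noteq> 0"
    by (simp add: in_keys_iff lin_def lookup_sum)
  then obtain b where "b \<in> Poly_Mapping.keys x" "Poly_Mapping.lookup (h b) k \<noteq> 0"
    by (metis (no_types, lifting) sum.neutral mult_zero_right)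
  then show "k \<in> C" using assms[of b] by (auto simp: in_keys_iff)
qed

lemma free_zero: "0 \<in> free_algebra G"
  and free_add: "\<lbrakk>a \<in> free_algebra G; b \<in> free_algebra G\<rbrakk> \<Longrightarrow> a + b \<in> free_algebra G"
  and free_smul: "a \<in> free_algebra G \<Longrightarrow> smul c a \<in> free_algebra G"
  and free_gen: "g \<in> G \<Longrightarrow> gen g \<in> free_algebra G"
  using keys_add[of a b] keys_smul[of c a] by (auto simp: free_algebra_def gen_def)

lemma free_mult: "\<lbrakk>a \<in> free_algebra G; b \<in> free_algebra G\<rbrakk> \<Longrightarrow> a * b \<in> free_algebra G"
  using keys_mult[of a b] by (fastforce simp: free_algebra_def plus_word_def)

lemma free_uminus: "a \<in> free_algebra G \<Longrightarrow> - a \<in> free_algebra G"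
  using free_smul[of a G "-1"] by (simp add: smul_minus)

lemma free_diff: "\<lbrakk>a \<in> free_algebra G; b \<in> free_algebra G\<rbrakk> \<Longrightarrow> a - b \<in> free_algebra G"
  using free_add[of a G "- b"] free_uminus by force

lemma free_sum: "(\<And>i. i \<in> S \<Longrightarrow> f i \<in> free_algebra G) \<Longrightarrow> (\<Sum>i\<in>S. f i) \<in> free_algebra G"
  by (induction S rule: infinite_finite_induct) (simp_all add: free_zero free_add)

lemma ideal_uminus: "a \<in> gen_ideal G R \<Longrightarrow> - a \<in> gen_ideal G R"
  using gen_ideal.scale[of a G R "-1"] by (simp add: smul_minus)

lemma ideal_diff: "\<lbrakk>a \<in> gen_ideal G R; b \<in> gen_ideal G R\<rbrakk> \<Longrightarrow> a - b \<in> gen_ideal G R"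
  using gen_ideal.add[OF _ ideal_uminus] by force

lemma in_coset_iff: "x \<in> coset_of I a \<longleftrightarrow> x - a \<in> I" for a :: "'x::ab_group_add"
  by (auto simp: coset_of_def) (metis add_diff_cancel_left' diff_add_cancel add.commute)

lemma coset_eq_iff: "coset_of (gen_ideal G R) a = coset_of (gen_ideal G R) b \<longleftrightarrow> a - b \<in> gen_ideal G R"
proof
  assume "coset_of (gen_ideal G R) a = coset_of (gen_ideal G R) b"
  then show "a - b \<in> gen_ideal G R"
    by (metis in_coset_iff diff_self gen_ideal.zero)
next
  assume *: "a - b \<in> gen_ideal G R"
  show "coset_of (gen_ideal G R) a = coset_of (gen_ideal G R) b"
  proof (rule set_eqI)
    fix x
    show "x \<in> coset_of (gen_ideal G R) a \<longleftrightarrow> x \<in> coset_of (gen_ideal G R) b"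
      using gen_ideal.add[OF _ *, of "x - a"] ideal_diff[OF _ *, of "x - b"]
      by (auto simp: in_coset_iff)
  qed
qed

lemma coset_self: "a \<in> coset_of (gen_ideal G R) a"
  by (simp add: in_coset_iff gen_ideal.zero)

lemma coset_nonempty: "coset_of (gen_ideal G R) a \<noteq> {}"
  using coset_self by blast

context
  fixes G :: "'g set" and R :: "('g word \<Rightarrow>\<^sub>0 'f::field) set"
  assumes R: "R \<subseteq> free_algebra G"
begin

abbreviation (input) cst where "cst \<equiv> coset_of (gen_ideal G R)"

lemma ideal_free: "a \<in> gen_ideal G R \<Longrightarrow> a \<in> free_algebra G"
  by (induction rule: gen_ideal.induct)
    (use R in \<open>auto intro: free_zero free_add free_smul free_mult\<close>)

lemma coset_free: "a \<in> free_algebra G \<Longrightarrow> x \<in> cst a \<Longrightarrow> x \<in> free_algebra G"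
  by (metis in_coset_iff ideal_free free_add diff_add_cancel)

lemma presented_carrier: "acarrier (presented_algebra G R) = cst ` free_algebra G"
  by (simp add: presented_algebra_def Let_def)

lemma presented_zero: "azero (presented_algebra G R) = cst 0"
  by (simp add: presented_algebra_def Let_def coset_of_def)

lemma presented_add: "aadd (presented_algebra G R) (cst a) (cst b) = cst (a + b)"
proof -
  have "cst (x + y) = cst (a + b)" if "x \<in> cst a" "y \<in> cst b" for x y
    using that gen_ideal.add[of "x - a" G R "y - b"]
    by (simp add: coset_eq_iff in_coset_iff algebra_simps)
  then have "(\<Union>x\<in>cst a. \<Union>y\<in>cst b. cst (x + y)) = cst (a + b)"
    by (intro SUP_eq_const) (auto simp: coset_nonempty)
  then show ?thesis by (simp add: presented_algebra_def Let_def)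
qed

lemma presented_scale: "ascale (presented_algebra G R) c (cst a) = cst (smul c a)"
proof -
  have "cst (smul c x) = cst (smul c a)" if "x \<in> cst a" for x
  proof -
    have "smul c x - smul c a = smul c (x - a)"
      by (rule poly_mapping_eqI) (simp add: lookup_minus right_diff_distrib)
    with that show ?thesis
      by (simp add: coset_eq_iff in_coset_iff gen_ideal.scale)
  qed
  then have "(\<Union>x\<in>cst a. cst (smul c x)) = cst (smul c a)"
    by (intro SUP_eq_const) (auto simp: coset_nonempty)
  then show ?thesis by (simp add: presented_algebra_def Let_def)
qed

lemma presented_mult:
  assumes "a \<in> free_algebra G" "b \<in> free_algebra G"
  shows "amult (presented_algebra G R) (cst a) (cst b) = cst (a * b)"
proof -
  have "cst (x * y) = cst (a * b)" if "x \<in> cst a" "y \<in> cst b" for x y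
  proof -
    have "y \<in> free_algebra G" using that assms coset_free by blast
    then have "(x - a) * y + a * (y - b) \<in> gen_ideal G R"
      using that assms by (auto simp: in_coset_iff intro: gen_ideal.intros)
    then show ?thesis by (simp add: coset_eq_iff algebra_simps)
  qed
  then have "(\<Union>x\<in>cst a. \<Union>y\<in>cst b. cst (x * y)) = cst (a * b)"
    by (intro SUP_eq_const) (auto simp: coset_nonempty)
  then show ?thesis by (simp add: presented_algebra_def Let_def)
qed

lemmas presented = presented_carrier presented_zero presented_add presented_scale presented_mult

lemma nonunital_algebra_presented: "nonunital_algebra (presented_algebra G R)"
proof
  fix x assume "x \<in> acarrier (presented_algebra G R)"
  then obtain a where a: "x = cst a" "a \<in> free_algebra G" by (auto simp: presented)
  then have "aadd (presented_algebra G R) (cst (- a)) x = azero (presented_algebra G R)"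
    by (simp add: presented)
  with a show "\<exists>y\<in>acarrier (presented_algebra G R).
      aadd (presented_algebra G R) y x = azero (presented_algebra G R)"
    by (metis free_uminus imageI presented_carrier)
qed (auto simp: presented algebra_simps smul_add_left smul_add_right smul_smul smul_mult_left
    smul_mult_right free_zero free_add free_smul free_mult)

end


subsection \<open>The action of the Kumjian-Pask algebra\<close>

lemma act_word_add: "act_word \<Delta> \<alpha> w (x + y) = act_word \<Delta> \<alpha> w x + act_word \<Delta> \<alpha> w y"
proof -
  have "foldr (\<lambda>g. lin (act_basis \<Delta> \<alpha> g)) l (x + y) =
      foldr (\<lambda>g. lin (act_basis \<Delta> \<alpha> g)) l x + foldr (\<lambda>g. lin (act_basis \<Delta> \<alpha> g)) l y" for l
    by (induction l) (simp_all add: lin_add)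
  then show ?thesis by (simp add: act_word_def)
qed

lemma act_word_smul: "act_word \<Delta> \<alpha> w (smul c x) = smul c (act_word \<Delta> \<alpha> w x)"
proof -
  have "foldr (\<lambda>g. lin (act_basis \<Delta> \<alpha> g)) l (smul c x) =
      smul c (foldr (\<lambda>g. lin (act_basis \<Delta> \<alpha> g)) l x)" for l
    by (induction l) (simp_all add: lin_smul)
  then show ?thesis by (simp add: act_word_def)
qed

lemma act_word_plus: "act_word \<Delta> \<alpha> (u + w) x = act_word \<Delta> \<alpha> u (act_word \<Delta> \<alpha> w x)"
  by (simp add: act_word_def plus_word_def)

lemma act_free_add_right: "act_free \<Delta> \<alpha> a (x + y) = act_free \<Delta> \<alpha> a x + act_free \<Delta> \<alpha> a y"
  by (simp add: act_free_def act_word_add lin_add_fun)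

lemma act_free_smul_right: "act_free \<Delta> \<alpha> a (smul c x) = smul c (act_free \<Delta> \<alpha> a x)"
  by (simp add: act_free_def act_word_smul lin_smul_fun)

lemma act_free_zero_right: "act_free \<Delta> \<alpha> a 0 = 0"
  using act_free_smul_right[of \<Delta> \<alpha> a 0 0] by simp

lemma act_free_sum_right:
  "act_free \<Delta> \<alpha> a (\<Sum>i\<in>S. f i) = (\<Sum>i\<in>S. act_free \<Delta> \<alpha> a (f i))"
  by (induction S rule: infinite_finite_induct)
    (simp_all add: act_free_zero_right act_free_add_right)

lemma act_free_zero: "act_free \<Delta> \<alpha> 0 x = 0"
  and act_free_add: "act_free \<Delta> \<alpha> (a + b) x = act_free \<Delta> \<alpha> a x + act_free \<Delta> \<alpha> b x"
  and act_free_diff: "act_free \<Delta> \<alpha> (a - b) x = act_free \<Delta> \<alpha> a x - act_free \<Delta> \<alpha> b x"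
  and act_free_smul: "act_free \<Delta> \<alpha> (smul c a) x = smul c (act_free \<Delta> \<alpha> a x)"
  and act_free_sum: "act_free \<Delta> \<alpha> (\<Sum>i\<in>S. f i) x = (\<Sum>i\<in>S. act_free \<Delta> \<alpha> (f i) x)"
  by (simp_all add: act_free_def lin_add lin_diff lin_smul lin_sum)

lemma act_free_single: "act_free \<Delta> \<alpha> (Poly_Mapping.single w c) x = smul c (act_word \<Delta> \<alpha> w x)"
  by (simp add: act_free_def lin_single)

lemma act_free_gen: "act_free \<Delta> \<alpha> (gen g) x = lin (act_basis \<Delta> \<alpha> g) x"
  by (simp add: gen_def act_free_single act_word_def)

lemma act_free_mult: "act_free \<Delta> \<alpha> (a * b) x = act_free \<Delta> \<alpha> a (act_free \<Delta> \<alpha> b x)"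
proof -
  have "act_free \<Delta> \<alpha> ((\<Sum>u\<in>S. Poly_Mapping.single u (f u)) * (\<Sum>w\<in>T. Poly_Mapping.single w (h w))) x =
      act_free \<Delta> \<alpha> (\<Sum>u\<in>S. Poly_Mapping.single u (f u))
        (act_free \<Delta> \<alpha> (\<Sum>w\<in>T. Poly_Mapping.single w (h w)) x)" for S T f h
    by (simp add: sum_product mult_single act_free_sum act_free_single act_free_sum_right
        act_free_smul_right act_word_plus act_word_smul smul_smul smul_sum mult.commute)
       (rule sum.swap)
  from this[where S = "Poly_Mapping.keys a" and f = "Poly_Mapping.lookup a"
      and T = "Poly_Mapping.keys b" and h = "Poly_Mapping.lookup b"]
  show ?thesis
    by (simp only: poly_mapping_expand[symmetric])
qed

lemma act_free_lin: "act_free \<Delta> \<alpha> a x = lin (\<lambda>v. act_free \<Delta> \<alpha> a (Poly_Mapping.single v 1)) x"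
proof -
  have "act_free \<Delta> \<alpha> a (\<Sum>v\<in>S. Poly_Mapping.single v (f v)) =
      lin (\<lambda>v. act_free \<Delta> \<alpha> a (Poly_Mapping.single v 1)) (\<Sum>v\<in>S. Poly_Mapping.single v (f v))"
    for S f
  proof -
    have *: "act_free \<Delta> \<alpha> a (Poly_Mapping.single v c) =
        smul c (act_free \<Delta> \<alpha> a (Poly_Mapping.single v 1))" for v c
      unfolding act_free_smul_right[symmetric] by (simp add: smul_def)
    show ?thesis
      unfolding act_free_sum_right lin_sum lin_single by (intro sum.cong refl *)
  qed
  from this[where S = "Poly_Mapping.keys x" and f = "Poly_Mapping.lookup x"]
  show ?thesis
    by (simp only: poly_mapping_expand[symmetric])
qed

lemma (in k_graph) Deg_zero_Ident:
  assumes "f \<in> Mor \<Lambda>" "Deg \<Lambda> f = 0"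
  shows "f = Ident \<Lambda> (Rng \<Lambda> f)" "Src \<Lambda> f = Rng \<Lambda> f"
proof -
  let ?P = "\<lambda>(g, h). g \<in> Mor \<Lambda> \<and> h \<in> Mor \<Lambda> \<and> Src \<Lambda> g = Rng \<Lambda> h \<and>
                 Deg \<Lambda> g = 0 \<and> Deg \<Lambda> h = 0 \<and> f = Comp \<Lambda> g h"
  have "\<exists>!p. ?P p"
    using unique_factorization[of f 0 0] assms by simp
  moreover have "?P (f, Ident \<Lambda> (Src \<Lambda> f))" "?P (Ident \<Lambda> (Rng \<Lambda> f), f)"
    using assms by (auto simp: Src_in Rng_in Ident_in Src_Ident Rng_Ident Deg_Ident
        Comp_Ident_left Comp_Ident_right)
  ultimately have "(f, Ident \<Lambda> (Src \<Lambda> f)) = (Ident \<Lambda> (Rng \<Lambda> f), f)"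
    by blast
  then show *: "f = Ident \<Lambda> (Rng \<Lambda> f)" by simp
  show "Src \<Lambda> f = Rng \<Lambda> f"
    using Src_Ident[of "Rng \<Lambda> f"] assms Rng_in * by metis
qed

context rep_k_graph
begin

declare act_basis.simps [simp del]

abbreviation (input) "bv v \<equiv> Poly_Mapping.single v 1"

lemma out_unique: "\<lbrakk>f \<in> out_of \<Delta> v; g \<in> out_of \<Delta> v; on_mor \<alpha> f = on_mor \<alpha> g\<rbrakk> \<Longrightarrow> f = g"
  using bij_out_of[of v] total.Src_in by (auto simp: bij_betw_def inj_on_def out_of_def)

lemma into_unique: "\<lbrakk>f \<in> into \<Delta> v; g \<in> into \<Delta> v; Deg \<Delta> f = Deg \<Delta> g\<rbrakk> \<Longrightarrow> f = g"
  using into_deg_singleton[of v "Deg \<Delta> f"] total.Rng_in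
  unfolding into_deg_def into_def by (smt (verit) mem_Collect_eq singletonD)

lemma into_unique': "\<lbrakk>f \<in> into \<Delta> v; g \<in> into \<Delta> v; on_mor \<alpha> f = on_mor \<alpha> g\<rbrakk> \<Longrightarrow> f = g"
  by (rule into_unique) (auto simp: into_def simp flip: map_Deg)

lemma out_exists: "\<lbrakk>v \<in> Obj \<Delta>; l \<in> Mor \<Lambda>; Src \<Lambda> l = on_obj \<alpha> v\<rbrakk> \<Longrightarrow> \<exists>f\<in>out_of \<Delta> v. on_mor \<alpha> f = l"
  using bij_betw_imp_surj_on[OF bij_out_of[of v]]
  unfolding out_of_def by (smt (verit) imageE mem_Collect_eq)

lemma act_Arr:
  assumes "f \<in> Mor \<Delta>" "Src \<Delta> f = v" "on_mor \<alpha> f = l"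
  shows "act_basis \<Delta> \<alpha> (Arr l) v = bv (Rng \<Delta> f)"
proof -
  have f: "f \<in> out_of \<Delta> v" using assms by (simp add: out_of_def)
  then have "(THE g. g \<in> out_of \<Delta> v \<and> on_mor \<alpha> g = l) = f"
    using assms out_unique by (intro the_equality) auto
  with f assms show ?thesis by (auto simp: act_basis.simps)
qed

lemma act_Arr_zero:
  assumes "v \<in> Obj \<Delta>" "l \<in> Mor \<Lambda>" "Src \<Lambda> l \<noteq> on_obj \<alpha> v"
  shows "act_basis \<Delta> \<alpha> (Arr l) v = 0"
  using assms map_Src by (auto simp: out_of_def act_basis.simps)

lemma act_star:
  assumes "f \<in> Mor \<Delta>" "Rng \<Delta> f = v" "on_mor \<alpha> f = l"
  shows "act_basis \<Delta> \<alpha> (star \<Lambda> l) v = bv (Src \<Delta> f)"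
proof (cases "Deg \<Lambda> l = 0")
  case True
  then have "Src \<Delta> f = v"
    using total.Deg_zero_Ident(2)[of f] assms map_Deg[of f] by simp
  then show ?thesis using act_Arr[of f v l] assms True by (simp add: star_def)
next
  case False
  have f: "f \<in> into \<Delta> v" using assms by (simp add: into_def)
  then have "(THE g. g \<in> into \<Delta> v \<and> on_mor \<alpha> g = l) = f"
    using assms into_unique' by (intro the_equality) auto
  with f assms False show ?thesis by (auto simp: star_def act_basis.simps)
qed

lemma act_star_zero:
  assumes "\<And>f. \<lbrakk>f \<in> Mor \<Delta>; Rng \<Delta> f = v\<rbrakk> \<Longrightarrow> on_mor \<alpha> f \<noteq> l"
  shows "act_basis \<Delta> \<alpha> (star \<Lambda> l) v = 0"
proof (cases "Deg \<Lambda> l = 0")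
  case True
  have "\<not> (\<exists>f\<in>out_of \<Delta> v. on_mor \<alpha> f = l)"
  proof
    assume "\<exists>f\<in>out_of \<Delta> v. on_mor \<alpha> f = l"
    then obtain f where f: "f \<in> Mor \<Delta>" "Src \<Delta> f = v" "on_mor \<alpha> f = l" by (auto simp: out_of_def)
    then have "Rng \<Delta> f = v"
      using total.Deg_zero_Ident(2)[of f] True map_Deg[of f] by simp
    then show False using assms f by blast
  qed
  then show ?thesis using True by (simp add: star_def act_basis.simps)
next
  case False
  then show ?thesis using assms by (auto simp: star_def into_def act_basis.simps)
qed

lemma act_Ident:
  assumes "v \<in> Obj \<Delta>" "u \<in> Obj \<Lambda>"
  shows "act_basis \<Delta> \<alpha> (Arr (Ident \<Lambda> u)) v = (if on_obj \<alpha> v = u then bv v else 0)"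
proof (cases "on_obj \<alpha> v = u")
  case True
  then show ?thesis
    using act_Arr[of "Ident \<Delta> v" v] assms
    by (simp add: total.Ident_in total.Src_Ident total.Rng_Ident map_Ident)
next
  case False
  then show ?thesis
    using act_Arr_zero assms base.Ident_in base.Src_Ident by metis
qed

lemma KP1_basis:
  assumes "f \<in> Mor \<Lambda>" "g \<in> Mor \<Lambda>" "v \<in> Obj \<Delta>"
  shows "lin (act_basis \<Delta> \<alpha> (Arr f)) (act_basis \<Delta> \<alpha> (Arr g) v :: _ \<Rightarrow>\<^sub>0 'z::field) =
    (if Src \<Lambda> f = Rng \<Lambda> g then act_basis \<Delta> \<alpha> (Arr (Comp \<Lambda> f g)) v else 0)"
proof (cases "Src \<Lambda> g = on_obj \<alpha> v")
  case True
  then obtain e where e: "e \<in> Mor \<Delta>" "Src \<Delta> e = v" "on_mor \<alpha> e = g"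
    using out_exists assms unfolding out_of_def by blast
  then have g: "act_basis \<Delta> \<alpha> (Arr g) v = (bv (Rng \<Delta> e) :: _ \<Rightarrow>\<^sub>0 'z::field)"
    by (rule act_Arr)
  have R: "Rng \<Lambda> g = on_obj \<alpha> (Rng \<Delta> e)" using e map_Rng by blast
  show ?thesis
  proof (cases "Src \<Lambda> f = Rng \<Lambda> g")
    case T: True
    then obtain e' where e': "e' \<in> Mor \<Delta>" "Src \<Delta> e' = Rng \<Delta> e" "on_mor \<alpha> e' = f"
      using out_exists[of "Rng \<Delta> e" f] assms R e total.Rng_in unfolding out_of_def by auto
    have "act_basis \<Delta> \<alpha> (Arr (Comp \<Lambda> f g)) v = (bv (Rng \<Delta> (Comp \<Delta> e' e)) :: _ \<Rightarrow>\<^sub>0 'z)"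
      using e e' by (intro act_Arr) (auto simp: total.Comp_in total.Src_Comp map_Comp)
    then show ?thesis
      using T e e' g by (simp add: lin_single total.Rng_Comp act_Arr[OF e'])
  next
    case False
    then have "act_basis \<Delta> \<alpha> (Arr f) (Rng \<Delta> e) = (0 :: _ \<Rightarrow>\<^sub>0 'z)"
      using assms R e total.Rng_in by (intro act_Arr_zero) auto
    then show ?thesis using False g by (simp add: lin_single)
  qed
next
  case False
  have "act_basis \<Delta> \<alpha> (Arr (Comp \<Lambda> f g)) v = (0 :: _ \<Rightarrow>\<^sub>0 'z::field)" if "Src \<Lambda> f = Rng \<Lambda> g"
    using assms False that by (intro act_Arr_zero) (auto simp: base.Comp_in base.Src_Comp)
  then show ?thesis using assms by (simp add: act_Arr_zero[OF _ _ False])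
qed

lemma KP2_basis:
  assumes "f \<in> Mor \<Lambda>" "g \<in> Mor \<Lambda>" "v \<in> Obj \<Delta>"
  shows "lin (act_basis \<Delta> \<alpha> (star \<Lambda> g)) (act_basis \<Delta> \<alpha> (star \<Lambda> f) v :: _ \<Rightarrow>\<^sub>0 'z::field) =
    (if Src \<Lambda> f = Rng \<Lambda> g then act_basis \<Delta> \<alpha> (star \<Lambda> (Comp \<Lambda> f g)) v else 0)"
proof (cases "\<exists>e e'. e \<in> Mor \<Delta> \<and> e' \<in> Mor \<Delta> \<and> Rng \<Delta> e = v \<and> on_mor \<alpha> e = f \<and>
    Src \<Delta> e = Rng \<Delta> e' \<and> on_mor \<alpha> e' = g")
  case True
  then obtain e e' where e: "e \<in> Mor \<Delta>" "Rng \<Delta> e = v" "on_mor \<alpha> e = f"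
    and e': "e' \<in> Mor \<Delta>" "Rng \<Delta> e' = Src \<Delta> e" "on_mor \<alpha> e' = g"
    by metis
  have "Src \<Lambda> f = Rng \<Lambda> g"
    using e e' map_Src map_Rng by metis
  moreover have "act_basis \<Delta> \<alpha> (star \<Lambda> (Comp \<Lambda> f g)) v = (bv (Src \<Delta> (Comp \<Delta> e e')) :: _ \<Rightarrow>\<^sub>0 'z::field)"
    using e e' by (intro act_star) (auto simp: total.Comp_in total.Rng_Comp map_Comp)
  ultimately show ?thesis
    using e e' by (simp add: act_star[OF e] act_star[OF e'] lin_single total.Src_Comp)
next
  case False
  have L: "lin (act_basis \<Delta> \<alpha> (star \<Lambda> g)) (act_basis \<Delta> \<alpha> (star \<Lambda> f) v) = (0 :: _ \<Rightarrow>\<^sub>0 'z::field)"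
  proof (cases "\<exists>e. e \<in> Mor \<Delta> \<and> Rng \<Delta> e = v \<and> on_mor \<alpha> e = f")
    case True
    then obtain e where e: "e \<in> Mor \<Delta>" "Rng \<Delta> e = v" "on_mor \<alpha> e = f" by blast
    have "act_basis \<Delta> \<alpha> (star \<Lambda> g) (Src \<Delta> e) = (0 :: _ \<Rightarrow>\<^sub>0 'z::field)"
      using False e by (intro act_star_zero) auto
    then show ?thesis by (simp add: act_star[OF e] lin_single)
  next
    case F: False
    then have "act_basis \<Delta> \<alpha> (star \<Lambda> f) v = (0 :: _ \<Rightarrow>\<^sub>0 'z::field)"
      by (intro act_star_zero) auto
    then show ?thesis by simp
  qed
  have "act_basis \<Delta> \<alpha> (star \<Lambda> (Comp \<Lambda> f g)) v = (0 :: _ \<Rightarrow>\<^sub>0 'z::field)" if T: "Src \<Lambda> f = Rng \<Lambda> g"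
  proof (rule act_star_zero)
    fix h assume h: "h \<in> Mor \<Delta>" "Rng \<Delta> h = v"
    show "on_mor \<alpha> h \<noteq> Comp \<Lambda> f g"
    proof
      assume *: "on_mor \<alpha> h = Comp \<Lambda> f g"
      let ?P = "\<lambda>(x, y). x \<in> Mor \<Lambda> \<and> y \<in> Mor \<Lambda> \<and> Src \<Lambda> x = Rng \<Lambda> y \<and>
                 Deg \<Lambda> x = Deg \<Lambda> f \<and> Deg \<Lambda> y = Deg \<Lambda> g \<and> Comp \<Lambda> f g = Comp \<Lambda> x y"
      have uniq: "\<exists>!p. ?P p"
        using base.unique_factorization[of "Comp \<Lambda> f g" "Deg \<Lambda> f" "Deg \<Lambda> g"] assms T
        by (simp add: base.Comp_in base.Deg_Comp)
      have "Deg \<Delta> h = Deg \<Lambda> f + Deg \<Lambda> g"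
        using map_Deg[OF h(1)] * assms T by (simp add: base.Deg_Comp)
      from ex1_implies_ex[OF total.unique_factorization[OF h(1) this]]
      obtain e e' where e: "e \<in> Mor \<Delta>" "e' \<in> Mor \<Delta>" "Src \<Delta> e = Rng \<Delta> e'"
        "Deg \<Delta> e = Deg \<Lambda> f" "Deg \<Delta> e' = Deg \<Lambda> g" "h = Comp \<Delta> e e'"
        by auto
      have "?P (on_mor \<alpha> e, on_mor \<alpha> e')"
        using e * by (auto simp: mor_in map_Src map_Rng map_Deg map_Comp)
      moreover have "?P (f, g)" using assms T by simp
      ultimately have "(on_mor \<alpha> e, on_mor \<alpha> e') = (f, g)" using uniq by blast
      then show False using False e h by (auto simp: total.Rng_Comp)
    qed
  qed
  then show ?thesis using L by simp
qed

lemma KP3_basis: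
  assumes "f \<in> Mor \<Lambda>" "g \<in> Mor \<Lambda>" "Deg \<Lambda> f = Deg \<Lambda> g" "v \<in> Obj \<Delta>"
  shows "lin (act_basis \<Delta> \<alpha> (star \<Lambda> f)) (act_basis \<Delta> \<alpha> (Arr g) v :: _ \<Rightarrow>\<^sub>0 'z::field) =
    (if f = g then act_basis \<Delta> \<alpha> (Arr (Ident \<Lambda> (Src \<Lambda> f))) v else 0)"
proof (cases "Src \<Lambda> g = on_obj \<alpha> v")
  case True
  then obtain e where e: "e \<in> Mor \<Delta>" "Src \<Delta> e = v" "on_mor \<alpha> e = g"
    using out_exists assms unfolding out_of_def by blast
  show ?thesis
  proof (cases "f = g")
    case T: True
    then show ?thesis using e True assms
      by (simp add: act_Arr[OF e] act_star[OF e(1) refl e(3)] act_Ident lin_single obj_in)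
  next
    case False
    have "act_basis \<Delta> \<alpha> (star \<Lambda> f) (Rng \<Delta> e) = (0 :: _ \<Rightarrow>\<^sub>0 'z::field)"
    proof (rule act_star_zero)
      fix h assume h: "h \<in> Mor \<Delta>" "Rng \<Delta> h = Rng \<Delta> e"
      show "on_mor \<alpha> h \<noteq> f"
        using into_unique[of h "Rng \<Delta> e" e] h e assms False map_Deg[of h] map_Deg[of e]
        by (auto simp: into_def)
    qed
    then show ?thesis using False by (simp add: act_Arr[OF e] lin_single)
  qed
next
  case False
  then show ?thesis
    using assms False by (auto simp: act_Arr_zero[OF _ _ False] act_Ident base.Src_in)
qed

lemma KP4_basis:
  assumes "u \<in> Obj \<Lambda>" "v \<in> Obj \<Delta>"
  shows "(\<Sum>f\<in>into_deg \<Lambda> u n. lin (act_basis \<Delta> \<alpha> (Arr f)) (act_basis \<Delta> \<alpha> (star \<Lambda> f) v :: _ \<Rightarrow>\<^sub>0 'z::field)) =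
    act_basis \<Delta> \<alpha> (Arr (Ident \<Lambda> u)) v"
proof -
  obtain e where "into_deg \<Delta> v n = {e}"
    using into_deg_singleton[OF assms(2)] by blast
  then have e: "e \<in> Mor \<Delta>" "Rng \<Delta> e = v" "Deg \<Delta> e = n"
    by (auto simp: into_deg_def into_def)
  have z: "act_basis \<Delta> \<alpha> (star \<Lambda> f) v = (0 :: _ \<Rightarrow>\<^sub>0 'z::field)" if "Deg \<Lambda> f = n" "f \<noteq> on_mor \<alpha> e" for f
  proof (rule act_star_zero)
    fix h assume h: "h \<in> Mor \<Delta>" "Rng \<Delta> h = v"
    show "on_mor \<alpha> h \<noteq> f"
      using into_unique[of h v e] h e that map_Deg[of h] by (auto simp: into_def)
  qed
  have t: "lin (act_basis \<Delta> \<alpha> (Arr (on_mor \<alpha> e))) (act_basis \<Delta> \<alpha> (star \<Lambda> (on_mor \<alpha> e)) v)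
      = (bv v :: _ \<Rightarrow>\<^sub>0 'z::field)"
    using e by (simp add: act_star[OF e(1,2) refl] act_Arr[OF e(1) refl refl] lin_single)
  have "(\<Sum>f\<in>into_deg \<Lambda> u n. lin (act_basis \<Delta> \<alpha> (Arr f)) (act_basis \<Delta> \<alpha> (star \<Lambda> f) v)) =
    (\<Sum>f\<in>into_deg \<Lambda> u n. if f = on_mor \<alpha> e then (bv v :: _ \<Rightarrow>\<^sub>0 'z) else 0)"
    by (rule sum.cong) (auto simp: t z into_deg_def)
  also have "\<dots> = (if on_mor \<alpha> e \<in> into_deg \<Lambda> u n then bv v else 0)"
    using base.row_finite[OF assms(1)] by simp
  also have "on_mor \<alpha> e \<in> into_deg \<Lambda> u n \<longleftrightarrow> on_obj \<alpha> v = u"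
    using e mor_in[of e] map_Rng[of e] map_Deg[of e] by (auto simp: into_deg_def into_def)
  finally show ?thesis by (simp add: act_Ident[OF assms(2,1)])
qed

lemma relator_act_basis:
  assumes "a \<in> kp_relators \<Lambda>" "v \<in> Obj \<Delta>"
  shows "act_free \<Delta> \<alpha> a (bv v) = 0"
  using assms(1)
proof cases
  case (KP1 f g)
  show ?thesis
    unfolding KP1(1) act_free_diff act_free_mult act_free_gen lin_single smul_one
      KP1_basis[OF KP1(2,3) assms(2)]
    by (simp add: act_free_gen act_free_zero lin_single)
next
  case (KP2 f g)
  show ?thesis
    unfolding KP2(1) act_free_diff act_free_mult act_free_gen lin_single smul_one
      KP2_basis[OF KP2(2,3) assms(2)]
    by (simp add: act_free_gen act_free_zero lin_single)
next
  case (KP3 f g)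
  show ?thesis
    unfolding KP3(1) act_free_diff act_free_mult act_free_gen lin_single smul_one
      KP3_basis[OF KP3(2-4) assms(2)]
    by (simp add: act_free_gen act_free_zero lin_single)
next
  case (KP4 u n)
  show ?thesis
    unfolding KP4(1) act_free_diff act_free_sum act_free_mult act_free_gen lin_single smul_one
      KP4_basis[OF KP4(2) assms(2)]
    by simp
qed

lemma relator_act:
  assumes "a \<in> kp_relators \<Lambda>" "Poly_Mapping.keys x \<subseteq> Obj \<Delta>"
  shows "act_free \<Delta> \<alpha> a x = 0"
proof -
  have "act_free \<Delta> \<alpha> a x = lin (\<lambda>v. 0) x"
    using assms relator_act_basis by (subst act_free_lin, intro lin_cong) auto
  then show ?thesis by (simp add: lin_def)
qed

lemma act_basis_keys: "Poly_Mapping.keys (act_basis \<Delta> \<alpha> g v) \<subseteq> Obj \<Delta>"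
proof (cases g)
  case (Arr l)
  show ?thesis
  proof (cases "\<exists>f\<in>out_of \<Delta> v. on_mor \<alpha> f = l")
    case True
    then obtain f where "f \<in> Mor \<Delta>" "Src \<Delta> f = v" "on_mor \<alpha> f = l" by (auto simp: out_of_def)
    then show ?thesis using total.Rng_in[of f] by (simp add: Arr act_Arr)
  qed (use Arr in \<open>auto simp: act_basis.simps\<close>)
next
  case (Star l)
  show ?thesis
  proof (cases "\<exists>f\<in>into \<Delta> v. on_mor \<alpha> f = l")
    case True
    then obtain f where f: "f \<in> into \<Delta> v" "on_mor \<alpha> f = l" by blast
    then have "(THE f. f \<in> into \<Delta> v \<and> on_mor \<alpha> f = l) = f"
      using into_unique' by (intro the_equality) auto
    then show ?thesis using f Star total.Src_in by (auto simp: into_def act_basis.simps)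
  qed (use Star in \<open>auto simp: act_basis.simps\<close>)
qed

lemma act_free_keys:
  assumes "Poly_Mapping.keys x \<subseteq> Obj \<Delta>"
  shows "Poly_Mapping.keys (act_free \<Delta> \<alpha> a x) \<subseteq> Obj \<Delta>"
proof -
  have "Poly_Mapping.keys (foldr (\<lambda>g. lin (act_basis \<Delta> \<alpha> g)) l x) \<subseteq> Obj \<Delta>" for l
  proof (induction l)
    case (Cons g l)
    show ?case unfolding foldr.simps o_apply by (rule lin_keys, rule act_basis_keys)
  qed (use assms in simp)
  then show ?thesis
    unfolding act_free_def act_word_def by (rule lin_keys)
qed

lemma ideal_act:
  assumes "a \<in> gen_ideal (kp_letters \<Lambda>) (kp_relators \<Lambda>)" "Poly_Mapping.keys x \<subseteq> Obj \<Delta>"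
  shows "act_free \<Delta> \<alpha> a x = 0"
  using assms
  by (induction arbitrary: x rule: gen_ideal.induct)
    (simp_all add: relator_act act_free_zero act_free_add act_free_smul act_free_mult
      act_free_zero_right act_free_keys)

lemma mact_rep_module:
  assumes "Poly_Mapping.keys x \<subseteq> Obj \<Delta>"
  shows "mact (rep_module \<Delta> \<alpha>) (coset_of (gen_ideal (kp_letters \<Lambda>) (kp_relators \<Lambda>)) a) x =
    act_free \<Delta> \<alpha> a x"
proof -
  let ?X = "coset_of (gen_ideal (kp_letters \<Lambda>) (kp_relators \<Lambda>)) a"
  have eq: "act_free \<Delta> \<alpha> b x = act_free \<Delta> \<alpha> a x" if "b \<in> ?X" for b
    using ideal_act[of "b - a" x] that assms by (simp add: in_coset_iff act_free_diff)
  have "(THE y. \<forall>b\<in>?X. y = act_free \<Delta> \<alpha> b x) = act_free \<Delta> \<alpha> a x"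
  proof (rule the_equality)
    show "\<forall>b\<in>?X. act_free \<Delta> \<alpha> a x = act_free \<Delta> \<alpha> b x"
      by (intro ballI eq[symmetric])
    show "y = act_free \<Delta> \<alpha> a x" if "\<forall>b\<in>?X. y = act_free \<Delta> \<alpha> b x" for y
      by (rule bspec[OF that coset_self])
  qed
  then show ?thesis by (simp add: rep_module_def)
qed

end

lemma (in standing_k_graph) relators_free: "kp_relators \<Lambda> \<subseteq> free_algebra (kp_letters \<Lambda>)"
proof
  have A: "gen (Arr f) \<in> free_algebra (kp_letters \<Lambda>)" if "f \<in> Mor \<Lambda>" for f
    using that by (intro free_gen) (simp add: kp_letters_def)
  have S: "gen (star \<Lambda> f) \<in> free_algebra (kp_letters \<Lambda>)" if "f \<in> Mor \<Lambda>" for f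
    using that by (intro free_gen) (simp add: kp_letters_def star_def)
  fix a assume "a \<in> kp_relators \<Lambda>"
  then show "a \<in> free_algebra (kp_letters \<Lambda>)"
    by cases (auto intro!: free_diff free_sum free_mult A S Comp_in Ident_in Src_in free_zero
        simp: into_deg_def into_def)
qed

lemma (in standing_k_graph) nonunital_algebra_KP: "nonunital_algebra (KP TYPE('f::field) \<Lambda>)"
  unfolding KP_def by (rule nonunital_algebra_presented[OF relators_free])

lemma (in rep_k_graph) left_module_rep_module:
  "left_module (KP TYPE('f::field) \<Lambda>) (rep_module \<Delta> \<alpha>)"
proof -
  let ?A = "KP TYPE('f) \<Lambda>" and ?M = "rep_module \<Delta> \<alpha> :: (_, 'f, _) lmod"
  have M: "mcarrier ?M = {x. Poly_Mapping.keys x \<subseteq> Obj \<Delta>}" "mzero ?M = 0" "madd ?M = (+)"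
    "mscale ?M = smul"
    by (simp_all add: rep_module_def)
  note P = KP_def presented[OF base.relators_free]
  interpret nonunital_algebra ?A by (rule base.nonunital_algebra_KP)
  show ?thesis
  proof
    show "\<exists>y\<in>mcarrier ?M. madd ?M y x = mzero ?M" if "x \<in> mcarrier ?M" for x
      using that by (intro bexI[of _ "- x"]) (auto simp: M in_keys_iff)
    show "madd ?M x y \<in> mcarrier ?M" if "x \<in> mcarrier ?M" "y \<in> mcarrier ?M" for x y
      using that keys_add[of x y] by (auto simp: M)
    show "mscale ?M c x \<in> mcarrier ?M" if "x \<in> mcarrier ?M" for c x
      using that keys_smul[of c x] by (auto simp: M)
  next
    fix a x assume "a \<in> acarrier ?A" "x \<in> mcarrier ?M"
    then show "mact ?M a x \<in> mcarrier ?M"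
      by (auto simp: P M mact_rep_module act_free_keys[THEN subsetD])
  next
    fix a x y assume *: "a \<in> acarrier ?A" "x \<in> mcarrier ?M" "y \<in> mcarrier ?M"
    then have "Poly_Mapping.keys (x + y) \<subseteq> Obj \<Delta>" using keys_add[of x y] by (auto simp: M)
    with * show "mact ?M a (madd ?M x y) = madd ?M (mact ?M a x) (mact ?M a y)"
      by (auto simp: P M mact_rep_module act_free_add_right)
  next
    fix a t x assume *: "a \<in> acarrier ?A" "x \<in> mcarrier ?M"
    then have "Poly_Mapping.keys (smul t x) \<subseteq> Obj \<Delta>" using keys_smul[of t x] by (auto simp: M)
    with * show "mact ?M a (mscale ?M t x) = mscale ?M t (mact ?M a x)"
      by (auto simp: P M mact_rep_module act_free_smul_right)
  qed (auto simp: P M mact_rep_module act_free_add act_free_smul act_free_mult act_free_keys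
      smul_add_left smul_add_right smul_smul algebra_simps)
qed

end

theory Submission
  imports Defs
begin

text \<open>
  A word in the letters \<open>\<lambda>\<close>, \<open>\<lambda>\<^sup>*\<close> sends a vertex \<open>v\<close> of \<open>\<Delta>\<close> to the endpoint of its lift
  to a walk from \<open>v\<close>, or to \<open>0\<close> if there is no such walk. It thus acts as a partial injection on
  the basis, with inverse the reversed word of starred letters.

  Let \<open>h\<close> be an injective module homomorphism and \<open>u\<close> a vertex of \<open>\<Delta>\<close>. If \<open>p\<close> lifts at some
  vertex in the support of \<open>h u\<close>, then \<open>p\<close> does not annihilate \<open>h u\<close>, hence not \<open>u\<close>, so
  \<open>p\<^sup>*p\<close> fixes \<open>u\<close> and therefore \<open>h u\<close>; this forces \<open>p\<close> to lift at every vertex of the support.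
  Irreducibility leaves only one vertex \<open>w\<close> in the support, and the same words lift at \<open>u\<close>
  and at \<open>w\<close>. The inverse of \<open>h\<close> gives the same correspondence in the other direction, and a
  vertex map preserving the sets of liftable words extends uniquely to morphisms.
\<close>

section \<open>Lifting words at a vertex\<close>

text \<open>A relation, because a letter acts only partially on vertices; it is later shown to be
  functional and injective.\<close>

definition letter_lift ::
  "('o, 'm, 'k::finite) kgraph \<Rightarrow> ('o, 'm, 'p, 'q) kmap \<Rightarrow> 'q letter \<Rightarrow> 'o \<Rightarrow> 'o \<Rightarrow> bool" where
  "letter_lift \<Delta> \<alpha> l v w \<longleftrightarrow>
     (\<exists>e\<in>edges \<Delta>. map_letter (on_mor \<alpha>) e = l \<and> edge_src \<Delta> e = v \<and> edge_rng \<Delta> e = w)"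

fun word_lift ::
  "('o, 'm, 'k::finite) kgraph \<Rightarrow> ('o, 'm, 'p, 'q) kmap \<Rightarrow> 'q letter list \<Rightarrow> 'o \<Rightarrow> 'o \<Rightarrow> bool" where
  "word_lift \<Delta> \<alpha> [] v w \<longleftrightarrow> v = w"
| "word_lift \<Delta> \<alpha> (l # p) v w \<longleftrightarrow> (\<exists>x. word_lift \<Delta> \<alpha> p v x \<and> letter_lift \<Delta> \<alpha> l x w)"

text \<open>The invariant by which vertices of different representation graphs are compared.\<close>

definition liftable ::
  "('o, 'm, 'k::finite) kgraph \<Rightarrow> ('o, 'm, 'p, 'q) kmap \<Rightarrow> 'o \<Rightarrow> 'q letter list set" where
  "liftable \<Delta> \<alpha> v = {p. \<exists>w. word_lift \<Delta> \<alpha> p v w}"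

lemma word_lift_append:
  "word_lift \<Delta> \<alpha> (p @ q) v w \<longleftrightarrow> (\<exists>x. word_lift \<Delta> \<alpha> q v x \<and> word_lift \<Delta> \<alpha> p x w)"
  by (induction p arbitrary: w) auto

text \<open>A walk can be built letter by letter from its source, so stepwise lifts are walks lying
  over \<open>p\<close>. One letter is the base case, since walks are nonempty.\<close>

lemma word_lift_walk:
  assumes "p \<noteq> []"
  shows "word_lift \<Delta> \<alpha> p v w \<longleftrightarrow>
    (\<exists>q\<in>walks_from \<Delta> v. edge_rng \<Delta> (hd q) = w \<and> map_walk \<alpha> q = p)"
  using assms
proof (induction p arbitrary: w)
  case (Cons l p)
  show ?case
  proof (cases "p = []")
    case True
    show ?thesis
    proof
      assume "word_lift \<Delta> \<alpha> (l # p) v w"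
      then obtain e where "e \<in> edges \<Delta>" "map_letter (on_mor \<alpha>) e = l"
        "edge_src \<Delta> e = v" "edge_rng \<Delta> e = w"
        by (auto simp: True letter_lift_def)
      then show "\<exists>q\<in>walks_from \<Delta> v. edge_rng \<Delta> (hd q) = w \<and> map_walk \<alpha> q = l # p"
        by (intro bexI[of _ "[e]"]) (auto simp: True walks_from_def walks_def map_walk_def)
    next
      assume "\<exists>q\<in>walks_from \<Delta> v. edge_rng \<Delta> (hd q) = w \<and> map_walk \<alpha> q = l # p"
      then show "word_lift \<Delta> \<alpha> (l # p) v w"
        by (auto simp: True letter_lift_def walks_from_def walks_def map_walk_def)
    qed
  next
    case False
    show ?thesis
    proof
      assume "word_lift \<Delta> \<alpha> (l # p) v w"
      then obtain x where x: "word_lift \<Delta> \<alpha> p v x" "letter_lift \<Delta> \<alpha> l x w" by auto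
      then obtain q e where "q \<in> walks_from \<Delta> v" "edge_rng \<Delta> (hd q) = x" "map_walk \<alpha> q = p"
        "e \<in> edges \<Delta>" "map_letter (on_mor \<alpha>) e = l" "edge_src \<Delta> e = x" "edge_rng \<Delta> e = w"
        using Cons.IH[OF False] by (auto simp: letter_lift_def)
      then show "\<exists>q\<in>walks_from \<Delta> v. edge_rng \<Delta> (hd q) = w \<and> map_walk \<alpha> q = l # p"
        by (intro bexI[of _ "e # q"])
          (auto simp: walks_from_def walks_def map_walk_def successively_Cons)
    next
      assume "\<exists>q\<in>walks_from \<Delta> v. edge_rng \<Delta> (hd q) = w \<and> map_walk \<alpha> q = l # p"
      then obtain e q where q: "e # q \<in> walks_from \<Delta> v" "edge_rng \<Delta> e = w"
        "map_letter (on_mor \<alpha>) e = l" "map_walk \<alpha> q = p"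
        by (auto simp: map_walk_def)
      have "q \<noteq> []" using q(4) False by (auto simp: map_walk_def)
      with q have "q \<in> walks_from \<Delta> v" "letter_lift \<Delta> \<alpha> l (edge_rng \<Delta> (hd q)) w"
        by (auto simp: walks_from_def walks_def successively_Cons letter_lift_def)
      then show "word_lift \<Delta> \<alpha> (l # p) v w"
        using Cons.IH[OF False] q(4) by auto
    qed
  qed
qed simp

lemma map_walk_walks_from: "map_walk \<alpha> ` walks_from \<Delta> u = liftable \<Delta> \<alpha> u - {[]}"
proof -
  have *: "p \<in> map_walk \<alpha> ` walks_from \<Delta> u \<longleftrightarrow> p \<in> liftable \<Delta> \<alpha> u" if "p \<noteq> []" for p
    using word_lift_walk[OF that, of \<Delta> \<alpha> u] by (fastforce simp: liftable_def)
  have "[] \<notin> map_walk \<alpha> ` walks_from \<Delta> u"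
    by (auto simp: map_walk_def walks_from_def walks_def)
  then have "p \<in> map_walk \<alpha> ` walks_from \<Delta> u \<longleftrightarrow> p \<in> liftable \<Delta> \<alpha> u - {[]}" for p
    using *[of p] by (cases "p = []") simp_all
  then show ?thesis by (rule set_eqI)
qed

lemma Nil_liftable: "[] \<in> liftable \<Delta> \<alpha> u"
proof -
  have "word_lift \<Delta> \<alpha> [] u u" by simp
  then show ?thesis unfolding liftable_def by blast
qed

text \<open>The empty word lifts at every vertex, so discarding it, as walks do, loses no
  information.\<close>

lemma rg_irreducible_iff:
  "rg_irreducible \<Delta> \<alpha> \<longleftrightarrow> inj_on (liftable \<Delta> \<alpha>) (Obj \<Delta>)"
proof -
  have "liftable \<Delta> \<alpha> u - {[]} = liftable \<Delta> \<alpha> v - {[]} \<longleftrightarrow> liftable \<Delta> \<alpha> u = liftable \<Delta> \<alpha> v"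
    for u v using Nil_liftable[of \<Delta> \<alpha> u] Nil_liftable[of \<Delta> \<alpha> v] by blast
  then show ?thesis
    by (auto simp: rg_irreducible_def map_walk_walks_from inj_on_def)
qed

text \<open>By unique factorization the morphisms of degree zero are exactly the identities, so the
  starred edges and the starred generators are the same.\<close>

lemma (in k_graph) edges_eq_kp_letters: "edges \<Lambda> = kp_letters \<Lambda>"
proof -
  have "f \<in> Ident \<Lambda> ` Obj \<Lambda> \<longleftrightarrow> Deg \<Lambda> f = 0" if "f \<in> Mor \<Lambda>" for f
    using that by (metis Deg_Ident Deg_zero_Ident(1) Rng_in imageE imageI)
  then show ?thesis by (auto simp: edges_def kp_letters_def)
qed

section \<open>Formal inverses of letters\<close>

fun inverse_letter :: "('o, 'm, 'k::finite) kgraph \<Rightarrow> 'm letter \<Rightarrow> 'm letter" where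
  "inverse_letter \<Lambda> (Arr f) = star \<Lambda> f"
| "inverse_letter \<Lambda> (Star f) = Arr f"

text \<open>A letter \<open>Arr f\<close> of degree zero is its own inverse. Membership in
  \<open>kp_letters\<close> excludes \<open>Star f\<close> of degree zero, which would return as
  \<open>Arr f\<close>.\<close>

lemma inverse_letter_inverse:
  "l \<in> kp_letters \<Lambda> \<Longrightarrow> inverse_letter \<Lambda> (inverse_letter \<Lambda> l) = l"
  by (auto simp: kp_letters_def star_def)

section \<open>Lifts as partial injections on vertices\<close>

context rep_k_graph
begin

lemma letter_lift_Arr:
  "letter_lift \<Delta> \<alpha> (Arr l) v w \<longleftrightarrow> (\<exists>f\<in>Mor \<Delta>. on_mor \<alpha> f = l \<and> Src \<Delta> f = v \<and> Rng \<Delta> f = w)"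
  by (auto simp: letter_lift_def total.edges_eq_kp_letters kp_letters_def bex_Un)

text \<open>As \<alpha> preserves degrees, the exclusion of starred identities upstairs becomes a
  condition on the label \<open>l\<close> alone.\<close>

lemma letter_lift_Star:
  "letter_lift \<Delta> \<alpha> (Star l) v w \<longleftrightarrow>
     (\<exists>f\<in>Mor \<Delta>. on_mor \<alpha> f = l \<and> Deg \<Lambda> l \<noteq> 0 \<and> Rng \<Delta> f = v \<and> Src \<Delta> f = w)"
proof -
  have "letter_lift \<Delta> \<alpha> (Star l) v w \<longleftrightarrow>
      (\<exists>f\<in>Mor \<Delta>. on_mor \<alpha> f = l \<and> Deg \<Delta> f \<noteq> 0 \<and> Rng \<Delta> f = v \<and> Src \<Delta> f = w)"
    by (auto simp: letter_lift_def total.edges_eq_kp_letters kp_letters_def bex_Un)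
  then show ?thesis by (metis map_Deg)
qed

lemma letter_lift_kp_letters: "letter_lift \<Delta> \<alpha> l v w \<Longrightarrow> l \<in> kp_letters \<Lambda>"
  by (cases l) (auto simp: letter_lift_Arr letter_lift_Star kp_letters_def mor_in)

text \<open>For \<open>Arr\<close> this is injectivity of \<alpha> on the morphisms out of
  \<open>v\<close>; for \<open>Star\<close> a morphism into \<open>v\<close> is determined by its
  degree, hence by its label.\<close>

lemma letter_lift_det: "\<lbrakk>letter_lift \<Delta> \<alpha> l v w; letter_lift \<Delta> \<alpha> l v w'\<rbrakk> \<Longrightarrow> w = w'"
proof (cases l)
  case (Arr f)
  assume "letter_lift \<Delta> \<alpha> l v w" "letter_lift \<Delta> \<alpha> l v w'"
  then obtain e e' where "e \<in> out_of \<Delta> v" "on_mor \<alpha> e = f" "Rng \<Delta> e = w"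
    "e' \<in> out_of \<Delta> v" "on_mor \<alpha> e' = f" "Rng \<Delta> e' = w'"
    by (auto simp: Arr letter_lift_Arr out_of_def)
  then show ?thesis using out_unique[of e v e'] by simp
next
  case (Star f)
  assume "letter_lift \<Delta> \<alpha> l v w" "letter_lift \<Delta> \<alpha> l v w'"
  then obtain e e' where "e \<in> into \<Delta> v" "on_mor \<alpha> e = f" "Src \<Delta> e = w"
    "e' \<in> into \<Delta> v" "on_mor \<alpha> e' = f" "Src \<Delta> e' = w'"
    by (auto simp: Star letter_lift_Star into_def)
  then show ?thesis using into_unique'[of e v e'] by simp
qed

lemma letter_lift_inverse:
  assumes "letter_lift \<Delta> \<alpha> l v w"
  shows "letter_lift \<Delta> \<alpha> (inverse_letter \<Lambda> l) w v"
proof (cases l)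
  case (Arr f)
  with assms obtain e where e: "e \<in> Mor \<Delta>" "on_mor \<alpha> e = f" "Src \<Delta> e = v" "Rng \<Delta> e = w"
    by (auto simp: letter_lift_Arr)
  show ?thesis
  proof (cases "Deg \<Lambda> f = 0")
    case True
    then have "v = w" using total.Deg_zero_Ident(2)[of e] e map_Deg[of e] by auto
    then show ?thesis using assms Arr True by (simp add: star_def)
  next
    case False
    then show ?thesis using Arr e by (auto simp: star_def letter_lift_Star)
  qed
qed (use assms in \<open>auto simp: letter_lift_Arr letter_lift_Star\<close>)

lemma word_lift_kp_letters: "word_lift \<Delta> \<alpha> p v w \<Longrightarrow> set p \<subseteq> kp_letters \<Lambda>"
proof (induction p arbitrary: w)
  case (Cons l p)
  then obtain x where "word_lift \<Delta> \<alpha> p v x" "letter_lift \<Delta> \<alpha> l x w" by auto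
  then show ?case using Cons.IH letter_lift_kp_letters by simp
qed simp

lemma word_lift_det: "\<lbrakk>word_lift \<Delta> \<alpha> p v w; word_lift \<Delta> \<alpha> p v w'\<rbrakk> \<Longrightarrow> w = w'"
proof (induction p arbitrary: w w')
  case (Cons l p)
  then obtain x x' where "word_lift \<Delta> \<alpha> p v x" "letter_lift \<Delta> \<alpha> l x w"
    "word_lift \<Delta> \<alpha> p v x'" "letter_lift \<Delta> \<alpha> l x' w'" by auto
  then show ?case using Cons.IH[of x x'] letter_lift_det by blast
qed simp

lemma word_lift_inverse:
  "word_lift \<Delta> \<alpha> p v w \<Longrightarrow> word_lift \<Delta> \<alpha> (rev (map (inverse_letter \<Lambda>) p)) w v"
proof (induction p arbitrary: w)
  case (Cons l p)
  then obtain x where "word_lift \<Delta> \<alpha> p v x" "letter_lift \<Delta> \<alpha> l x w" by auto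
  then have "word_lift \<Delta> \<alpha> (rev (map (inverse_letter \<Lambda>) p)) x v"
    "word_lift \<Delta> \<alpha> [inverse_letter \<Lambda> l] w x"
    using Cons.IH letter_lift_inverse by simp_all
  then show ?case by (auto simp only: list.map rev.simps word_lift_append)
qed simp

lemma word_lift_inverse':
  assumes "word_lift \<Delta> \<alpha> (rev (map (inverse_letter \<Lambda>) p)) v w" "set p \<subseteq> kp_letters \<Lambda>"
  shows "word_lift \<Delta> \<alpha> p w v"
proof -
  have "map (inverse_letter \<Lambda> \<circ> inverse_letter \<Lambda>) p = p"
    using assms(2) by (intro map_idI) (auto simp: inverse_letter_inverse)
  then show ?thesis
    using word_lift_inverse[OF assms(1)] by (simp add: rev_map)
qed

text \<open>Reversal turns injectivity into determinism: both \<open>v\<close> and \<open>v'\<close>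
  are endpoints of the inverse word lifted at \<open>w\<close>.\<close>

lemma word_lift_inj:
  assumes "word_lift \<Delta> \<alpha> p v w" "word_lift \<Delta> \<alpha> p v' w"
  shows "v = v'"
  using assms[THEN word_lift_inverse] by (rule word_lift_det)

text \<open>Since \<open>l\<close> leads from \<open>v\<close> only to \<open>w\<close>, the
  invariant of \<open>w\<close> can be read off from that of \<open>v\<close>. This is what will
  make vertex maps respect ranges.\<close>

lemma liftable_step:
  assumes "letter_lift \<Delta> \<alpha> l v w"
  shows "liftable \<Delta> \<alpha> w = {p. p @ [l] \<in> liftable \<Delta> \<alpha> v}"
proof -
  have "letter_lift \<Delta> \<alpha> l v x \<longleftrightarrow> x = w" for x
    using assms letter_lift_det by blast
  then have "word_lift \<Delta> \<alpha> (p @ [l]) v = word_lift \<Delta> \<alpha> p w" for p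
    by (intro ext) (simp add: word_lift_append)
  then show ?thesis by (simp add: liftable_def)
qed

subsection \<open>The action in terms of lifts\<close>

lemma act_basis_lift:
  assumes "letter_lift \<Delta> \<alpha> l v w"
  shows "act_basis \<Delta> \<alpha> l v = bv w"
proof (cases l)
  case (Arr f)
  with assms obtain e where "e \<in> Mor \<Delta>" "Src \<Delta> e = v" "on_mor \<alpha> e = f" "Rng \<Delta> e = w"
    by (auto simp: letter_lift_Arr)
  then show ?thesis using act_Arr[of e v f] Arr by simp
next
  case (Star f)
  with assms obtain e where "e \<in> Mor \<Delta>" "Rng \<Delta> e = v" "on_mor \<alpha> e = f" "Src \<Delta> e = w"
      "Deg \<Lambda> f \<noteq> 0"
    by (auto simp: letter_lift_Star)
  then show ?thesis using act_star[of e v f] Star by (simp add: star_def)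
qed

text \<open>The first hypothesis excludes starred letters of degree zero, which have no lifts
  although \<open>act_basis\<close> may be nonzero on them.\<close>

lemma act_basis_no_lift:
  assumes "l \<in> kp_letters \<Lambda>" "\<nexists>w. letter_lift \<Delta> \<alpha> l v w"
  shows "act_basis \<Delta> \<alpha> l v = 0"
proof (cases l)
  case (Arr f)
  then have "\<not> (\<exists>e\<in>out_of \<Delta> v. on_mor \<alpha> e = f)"
    using assms(2) by (auto simp: letter_lift_Arr out_of_def)
  then show ?thesis by (simp only: Arr act_basis.simps if_False)
next
  case (Star f)
  then have "\<not> (\<exists>e\<in>into \<Delta> v. on_mor \<alpha> e = f)"
    using assms by (auto simp: letter_lift_Star into_def kp_letters_def)
  then show ?thesis by (simp only: Star act_basis.simps if_False)
qed

lemma act_word_lift: "word_lift \<Delta> \<alpha> p v w \<Longrightarrow> act_word \<Delta> \<alpha> (Word p) (bv v) = bv w"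
  by (induction p arbitrary: w)
    (auto simp: act_word_def lin_single act_basis_lift)

text \<open>The vector becomes zero at the first letter that cannot be lifted and stays zero under
  the remaining ones.\<close>

lemma act_word_no_lift:
  "\<lbrakk>set p \<subseteq> kp_letters \<Lambda>; p \<notin> liftable \<Delta> \<alpha> v\<rbrakk> \<Longrightarrow>
     act_word \<Delta> \<alpha> (Word p) (bv v) = (0 :: _ \<Rightarrow>\<^sub>0 'z::field)"
proof (induction p)
  case (Cons l p)
  show ?case
  proof (cases "p \<in> liftable \<Delta> \<alpha> v")
    case True
    then obtain x where x: "word_lift \<Delta> \<alpha> p v x" by (auto simp: liftable_def)
    then have "act_basis \<Delta> \<alpha> l x = (0 :: _ \<Rightarrow>\<^sub>0 'z)"
      using Cons.prems by (intro act_basis_no_lift) (auto simp: liftable_def)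
    moreover have "act_word \<Delta> \<alpha> (Word p) (bv v) = (bv x :: _ \<Rightarrow>\<^sub>0 'z)"
      using x by (rule act_word_lift)
    ultimately show ?thesis by (simp add: act_word_def lin_single)
  next
    case False
    then show ?thesis using Cons by (simp add: act_word_def)
  qed
qed (simp add: Nil_liftable)

text \<open>Because words act by partial injections, distinct basis vectors never contribute to the
  same vertex, so no cancellation occurs in the support.\<close>

lemma keys_act_word:
  fixes x :: "_ \<Rightarrow>\<^sub>0 'z::field"
  assumes p: "set p \<subseteq> kp_letters \<Lambda>"
  shows "Poly_Mapping.keys (act_word \<Delta> \<alpha> (Word p) x) =
    {w. \<exists>v\<in>Poly_Mapping.keys x. word_lift \<Delta> \<alpha> p v w}" (is "?L = ?R")
proof -
  have ex: "act_word \<Delta> \<alpha> (Word p) x = lin (\<lambda>v. act_word \<Delta> \<alpha> (Word p) (bv v)) x"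
    using act_free_lin[of \<Delta> \<alpha> "Poly_Mapping.single (Word p) 1" x] by (simp add: act_free_single)
  have lk: "Poly_Mapping.lookup (act_word \<Delta> \<alpha> (Word p) (bv v) :: _ \<Rightarrow>\<^sub>0 'z) w =
      (if word_lift \<Delta> \<alpha> p v w then 1 else 0)" for v w
  proof (cases "p \<in> liftable \<Delta> \<alpha> v")
    case True
    then obtain y where y: "word_lift \<Delta> \<alpha> p v y" by (auto simp: liftable_def)
    then show ?thesis
      using word_lift_det[OF y, of w] by (auto simp: act_word_lift[OF y] lookup_single when_def)
  next
    case False
    then show ?thesis using act_word_no_lift[OF p False, where 'z = 'z] by (auto simp: liftable_def)
  qed
  have sum: "Poly_Mapping.lookup (act_word \<Delta> \<alpha> (Word p) x) w =
      (\<Sum>v\<in>Poly_Mapping.keys x. Poly_Mapping.lookup x v * (if word_lift \<Delta> \<alpha> p v w then 1 else 0))" for w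
    unfolding ex lin_def by (simp add: lookup_sum lk)
  show ?thesis
  proof
    show "?L \<subseteq> ?R"
    proof
      fix w assume "w \<in> ?L"
      from sum.not_neutral_contains_not_neutral[OF this[unfolded in_keys_iff sum]]
      obtain v where "v \<in> Poly_Mapping.keys x"
          "Poly_Mapping.lookup x v * (if word_lift \<Delta> \<alpha> p v w then 1 else 0) \<noteq> 0" .
      then show "w \<in> ?R" by (auto split: if_splits)
    qed
    show "?R \<subseteq> ?L"
    proof
      fix w assume "w \<in> ?R"
      then obtain v where v: "v \<in> Poly_Mapping.keys x" "word_lift \<Delta> \<alpha> p v w" by blast
      \<comment> \<open>Injectivity reduces the coefficient at \<open>w\<close> to the single
        summand from \<open>v\<close>.\<close>
      have "word_lift \<Delta> \<alpha> p v' w \<longleftrightarrow> v' = v" for v'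
        using v(2) word_lift_inj by blast
      then have "Poly_Mapping.lookup (act_word \<Delta> \<alpha> (Word p) x) w =
          (\<Sum>v'\<in>Poly_Mapping.keys x. if v' = v then Poly_Mapping.lookup x v else 0)"
        unfolding sum by (intro sum.cong) simp_all
      then show "w \<in> ?L" using v by (simp add: in_keys_iff)
    qed
  qed
qed

end

section \<open>From module homomorphisms to vertices\<close>

text \<open>A nonempty word acts as the coset of its monomial, which is an element of the algebra.
  The empty word has no such coset, the free algebra being non-unital, but it acts as the
  identity.\<close>

lemma hom_act_word:
  fixes h :: "('o \<Rightarrow>\<^sub>0 'f::field) \<Rightarrow> ('s \<Rightarrow>\<^sub>0 'f)"
  assumes "rep_k_graph \<Lambda> \<Delta> \<alpha>" "rep_k_graph \<Lambda> \<Sigma> \<beta>"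
    and hom: "module_hom (KP TYPE('f) \<Lambda>) (rep_module \<Delta> \<alpha>) (rep_module \<Sigma> \<beta>) h"
    and x: "Poly_Mapping.keys x \<subseteq> Obj \<Delta>" and p: "set p \<subseteq> kp_letters \<Lambda>"
  shows "h (act_word \<Delta> \<alpha> (Word p) x) = act_word \<Sigma> \<beta> (Word p) (h x)"
proof (cases "p = []")
  case False
  interpret D: rep_k_graph \<Lambda> \<Delta> \<alpha> by fact
  interpret S: rep_k_graph \<Lambda> \<Sigma> \<beta> by fact
  let ?I = "gen_ideal (kp_letters \<Lambda>) (kp_relators \<Lambda>) :: ('b letter word \<Rightarrow>\<^sub>0 'f) set"
  let ?a = "Poly_Mapping.single (Word p) 1 :: 'b letter word \<Rightarrow>\<^sub>0 'f"
  have "?a \<in> free_algebra (kp_letters \<Lambda>)"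
    using p False by (simp add: free_algebra_def)
  then have a: "coset_of ?I ?a \<in> acarrier (KP TYPE('f) \<Lambda>)"
    by (simp add: KP_def presented_carrier[OF D.base.relators_free])
  have hx: "Poly_Mapping.keys (h x) \<subseteq> Obj \<Sigma>"
    using hom x by (simp add: module_hom_def rep_module_def)
  have "h (mact (rep_module \<Delta> \<alpha>) (coset_of ?I ?a) x) = mact (rep_module \<Sigma> \<beta>) (coset_of ?I ?a) (h x)"
    using hom a x by (simp add: module_hom_def rep_module_def)
  then show ?thesis
    by (simp add: D.mact_rep_module[OF x] S.mact_rep_module[OF hx] act_free_single)
qed (simp add: act_word_def)

text \<open>Compatibility with each operation is checked after applying \<open>h\<close>; closure of
  the carrier of \<open>M\<close> under the operations makes this legitimate.\<close>

lemma module_hom_inverse: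
  assumes "left_module A M" and hom: "module_hom A M N h"
    and bij: "bij_betw h (mcarrier M) (mcarrier N)"
  shows "module_hom A N M (inv_into (mcarrier M) h)"
proof -
  interpret left_module A M by fact
  let ?k = "inv_into (mcarrier M) h"
  have k: "?k y \<in> mcarrier M" "h (?k y) = y" if "y \<in> mcarrier N" for y
    using that bij by (auto simp: bij_betw_def inv_into_into f_inv_into_f)
  have eq: "?k y = x" if "x \<in> mcarrier M" "h x = y" for x y
    using that bij by (auto simp: bij_betw_def)
  show ?thesis
    unfolding module_hom_def
  proof (intro conjI ballI allI)
    fix x assume "x \<in> mcarrier N"
    then show "?k x \<in> mcarrier M" by (rule k)
  next
    fix x y assume "x \<in> mcarrier N" "y \<in> mcarrier N"
    then show "?k (madd N x y) = madd M (?k x) (?k y)"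
      using k hom by (intro eq) (auto simp: add_in module_hom_def)
  next
    fix c x assume "x \<in> mcarrier N"
    then show "?k (mscale N c x) = mscale M c (?k x)"
      using k hom by (intro eq) (auto simp: scale_in module_hom_def)
  next
    fix a x assume "a \<in> acarrier A" "x \<in> mcarrier N"
    then show "?k (mact N a x) = mact M a (?k x)"
      using k hom by (intro eq) (auto simp: act_in module_hom_def)
  qed
qed

lemma injective_hom_vertex:
  fixes h :: "('o \<Rightarrow>\<^sub>0 'f::field) \<Rightarrow> ('s \<Rightarrow>\<^sub>0 'f)"
  assumes "rep_k_graph \<Lambda> \<Delta> \<alpha>" "rep_k_graph \<Lambda> \<Sigma> \<beta>" "rg_irreducible \<Sigma> \<beta>"
    and hom: "module_hom (KP TYPE('f) \<Lambda>) (rep_module \<Delta> \<alpha>) (rep_module \<Sigma> \<beta>) h"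
    and inj: "inj_on h (mcarrier (rep_module \<Delta> \<alpha>))"
    and u: "u \<in> Obj \<Delta>"
  shows "\<exists>w\<in>Obj \<Sigma>. liftable \<Sigma> \<beta> w = liftable \<Delta> \<alpha> u"
proof -
  interpret D: rep_k_graph \<Lambda> \<Delta> \<alpha> by fact
  interpret S: rep_k_graph \<Lambda> \<Sigma> \<beta> by fact
  let ?u = "Poly_Mapping.single u 1 :: 'o \<Rightarrow>\<^sub>0 'f"
  let ?K = "Poly_Mapping.keys (h ?u)"
  have C: "mcarrier (rep_module \<Delta> \<alpha> :: (_, 'f, _) lmod) = {x. Poly_Mapping.keys x \<subseteq> Obj \<Delta>}"
    by (simp add: rep_module_def)
  \<comment> \<open>Preservation of zero is not part of \<open>module_hom\<close>; it comes from
    scaling by 0.\<close>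
  have h0: "h 0 = 0"
  proof -
    have "0 \<in> mcarrier (rep_module \<Delta> \<alpha> :: (_, 'f, _) lmod)" by (simp add: C)
    with hom have "h (mscale (rep_module \<Delta> \<alpha>) 0 0) = mscale (rep_module \<Sigma> \<beta>) 0 (h 0)"
      unfolding module_hom_def by blast
    then show ?thesis by (simp add: rep_module_def)
  qed
  have act: "h (act_word \<Delta> \<alpha> (Word p) ?u) = act_word \<Sigma> \<beta> (Word p) (h ?u)"
    if "set p \<subseteq> kp_letters \<Lambda>" for p
    using u that by (intro hom_act_word[OF assms(1,2) hom]) auto
  have h_eq_0: "h x = 0 \<longleftrightarrow> x = 0" if "Poly_Mapping.keys x \<subseteq> Obj \<Delta>" for x
    using inj_on_eq_iff[OF inj, of x 0] that h0 by (simp add: C)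
  have K: "?K \<subseteq> Obj \<Sigma>"
    using hom u by (simp add: module_hom_def rep_module_def)
  have "Poly_Mapping.keys ?u \<noteq> {}" by simp
  then have "?u \<noteq> 0" by (metis keys_zero)
  then have "h ?u \<noteq> 0" using h_eq_0[of ?u] u by simp
  then have "?K \<noteq> {}" by simp
  \<comment> \<open>The endpoint of the lift survives in the support of \<open>p\<close> applied to
    \<open>h ?u\<close>, so \<open>p\<close> cannot annihilate \<open>?u\<close>.\<close>
  have down: "p \<in> liftable \<Delta> \<alpha> u" if w: "w \<in> ?K" "p \<in> liftable \<Sigma> \<beta> w" for p w
  proof -
    from w(2) obtain y where y: "word_lift \<Sigma> \<beta> p w y" by (auto simp: liftable_def)
    then have p: "set p \<subseteq> kp_letters \<Lambda>" by (rule S.word_lift_kp_letters)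
    have "y \<in> Poly_Mapping.keys (act_word \<Sigma> \<beta> (Word p) (h ?u))"
      using w y by (auto simp: S.keys_act_word[OF p])
    then have "act_word \<Delta> \<alpha> (Word p) ?u \<noteq> 0"
      by (metis act[OF p] h0 keys_zero empty_iff)
    then show ?thesis using D.act_word_no_lift[OF p] by blast
  qed
  \<comment> \<open>The loop \<open>?q @ p\<close> fixes \<open>?u\<close>, hence
    \<open>h ?u\<close>. So \<open>w\<close> is an endpoint of a lift of this loop, whose last part,
    along \<open>?q\<close>, reverses to a lift of \<open>p\<close> starting at
    \<open>w\<close>.\<close>
  have all: "p \<in> liftable \<Sigma> \<beta> w" if p: "p \<in> liftable \<Delta> \<alpha> u" and w: "w \<in> ?K" for p w
  proof -
    from p obtain x where x: "word_lift \<Delta> \<alpha> p u x" by (auto simp: liftable_def)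
    then have p: "set p \<subseteq> kp_letters \<Lambda>" by (rule D.word_lift_kp_letters)
    let ?q = "rev (map (inverse_letter \<Lambda>) p)"
    have loop: "word_lift \<Delta> \<alpha> (?q @ p) u u"
      using x D.word_lift_inverse[OF x] by (auto simp: word_lift_append)
    then have qp: "set (?q @ p) \<subseteq> kp_letters \<Lambda>" by (rule D.word_lift_kp_letters)
    have "act_word \<Delta> \<alpha> (Word (?q @ p)) ?u = ?u"
      by (rule D.act_word_lift[OF loop])
    from act[OF qp, unfolded this] have "act_word \<Sigma> \<beta> (Word (?q @ p)) (h ?u) = h ?u"
      by (rule sym)
    then have "w \<in> Poly_Mapping.keys (act_word \<Sigma> \<beta> (Word (?q @ p)) (h ?u))"
      using w by simp
    then obtain z where "word_lift \<Sigma> \<beta> ?q z w"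
      unfolding S.keys_act_word[OF qp] by (auto simp: word_lift_append)
    then show ?thesis
      using S.word_lift_inverse' p by (auto simp: liftable_def)
  qed
  \<comment> \<open>Every vertex of the support has the same liftable words as \<open>u\<close>; any
    of them is a witness.\<close>
  from \<open>?K \<noteq> {}\<close> obtain w where "w \<in> ?K" by blast
  with down all K show ?thesis by blast
qed

section \<open>From vertices to morphisms\<close>

text \<open>A morphism \<open>f\<close> must go to the unique lift of its label starting at
  \<open>F (Src \<Delta> f)\<close>. Equality of liftable words makes the lift exist, and with
  irreducibility makes it end at \<open>F (Rng \<Delta> f)\<close>.\<close>

lemma rg_morphism_of_vertex_map:
  assumes "rep_k_graph \<Lambda> \<Delta> \<alpha>" "rep_k_graph \<Lambda> \<Sigma> \<beta>" "rg_irreducible \<Sigma> \<beta>"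
    and F: "\<And>u. u \<in> Obj \<Delta> \<Longrightarrow> F u \<in> Obj \<Sigma> \<and> liftable \<Sigma> \<beta> (F u) = liftable \<Delta> \<alpha> u"
  shows "\<exists>\<phi>. rg_morphism \<Delta> \<alpha> \<Sigma> \<beta> \<phi> \<and> on_obj \<phi> = F"
proof -
  interpret D: rep_k_graph \<Lambda> \<Delta> \<alpha> by fact
  interpret S: rep_k_graph \<Lambda> \<Sigma> \<beta> by fact
  have obj: "on_obj \<beta> (F u) = on_obj \<alpha> u" if u: "u \<in> Obj \<Delta>" for u
  proof -
    have "letter_lift \<Delta> \<alpha> (Arr (Ident \<Lambda> (on_obj \<alpha> u))) u u"
      using u D.total.Ident_in D.total.Src_Ident D.total.Rng_Ident D.map_Ident
      by (auto simp: D.letter_lift_Arr intro!: bexI[of _ "Ident \<Delta> u"])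
    then have "[Arr (Ident \<Lambda> (on_obj \<alpha> u))] \<in> liftable \<Delta> \<alpha> u"
      by (auto simp: liftable_def)
    then have "[Arr (Ident \<Lambda> (on_obj \<alpha> u))] \<in> liftable \<Sigma> \<beta> (F u)"
      using F[OF u] by simp
    then obtain g where "g \<in> Mor \<Sigma>" "Src \<Sigma> g = F u" "on_mor \<beta> g = Ident \<Lambda> (on_obj \<alpha> u)"
      by (auto simp: liftable_def S.letter_lift_Arr)
    then show ?thesis
      by (metis S.map_Src D.base.Src_Ident D.obj_in u)
  qed
  define M where "M f = (THE g. g \<in> out_of \<Sigma> (F (Src \<Delta> f)) \<and> on_mor \<beta> g = on_mor \<alpha> f)" for f
  have M_eq: "M f = g" if "g \<in> Mor \<Sigma>" "Src \<Sigma> g = F (Src \<Delta> f)" "on_mor \<beta> g = on_mor \<alpha> f" for f g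
    unfolding M_def using that S.out_unique by (intro the_equality) (auto simp: out_of_def)
  have M: "M f \<in> Mor \<Sigma> \<and> Src \<Sigma> (M f) = F (Src \<Delta> f) \<and> on_mor \<beta> (M f) = on_mor \<alpha> f \<and>
      Rng \<Sigma> (M f) = F (Rng \<Delta> f)" if f: "f \<in> Mor \<Delta>" for f
  proof -
    have s: "Src \<Delta> f \<in> Obj \<Delta>" and r: "Rng \<Delta> f \<in> Obj \<Delta>"
      using f by (auto simp: D.total.Src_in D.total.Rng_in)
    obtain g where g: "g \<in> Mor \<Sigma>" "Src \<Sigma> g = F (Src \<Delta> f)" "on_mor \<beta> g = on_mor \<alpha> f"
      using S.out_exists[of "F (Src \<Delta> f)" "on_mor \<alpha> f"] F[OF s] obj[OF s] f
      by (auto simp: D.mor_in D.map_Src out_of_def)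
    have "letter_lift \<Delta> \<alpha> (Arr (on_mor \<alpha> f)) (Src \<Delta> f) (Rng \<Delta> f)"
      "letter_lift \<Sigma> \<beta> (Arr (on_mor \<alpha> f)) (F (Src \<Delta> f)) (Rng \<Sigma> g)"
      using f g by (auto simp: D.letter_lift_Arr S.letter_lift_Arr)
    then have "liftable \<Sigma> \<beta> (Rng \<Sigma> g) = liftable \<Delta> \<alpha> (Rng \<Delta> f)"
      using F[OF s] by (simp add: D.liftable_step S.liftable_step)
    then have "Rng \<Sigma> g = F (Rng \<Delta> f)"
      using F[OF r] assms(3) S.total.Rng_in[OF g(1)]
      by (auto simp: rg_irreducible_iff dest: inj_onD)
    then show ?thesis using g M_eq[OF g] by simp
  qed
  let ?\<phi> = "\<lparr>on_obj = F, on_mor = M\<rparr>"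
  have "k_graph_morphism \<Delta> \<Sigma> ?\<phi>"
  proof
    fix v assume v: "v \<in> Obj \<Delta>"
    then show "on_mor ?\<phi> (Ident \<Delta> v) = Ident \<Sigma> (on_obj ?\<phi> v)"
      using F[OF v] obj[OF v]
      by (auto simp: S.total.Ident_in S.total.Src_Ident D.total.Src_Ident S.map_Ident D.map_Ident
          intro!: M_eq)
  next
    fix f g assume *: "f \<in> Mor \<Delta>" "g \<in> Mor \<Delta>" "Src \<Delta> f = Rng \<Delta> g"
    have "M (Comp \<Delta> f g) = Comp \<Sigma> (M f) (M g)"
      using * M[of f] M[of g]
      by (intro M_eq) (simp_all add: S.total.Comp_in S.total.Src_Comp D.total.Src_Comp S.map_Comp
          D.map_Comp)
    then show "on_mor ?\<phi> (Comp \<Delta> f g) = Comp \<Sigma> (on_mor ?\<phi> f) (on_mor ?\<phi> g)" by simp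
  next
    fix f assume f: "f \<in> Mor \<Delta>"
    then show "Deg \<Sigma> (on_mor ?\<phi> f) = Deg \<Delta> f"
      using M[OF f] S.map_Deg[of "M f"] D.map_Deg[OF f] by simp
  qed (use F M in auto)
  then have "rg_morphism \<Delta> \<alpha> \<Sigma> \<beta> ?\<phi>"
    using obj M by (simp add: rg_morphism_def)
  then show ?thesis by (metis kmap.select_convs(1))
qed

lemma (in rep_k_graph) rg_morphism_retract:
  assumes \<phi>: "rg_morphism \<Delta> \<alpha> \<Sigma> \<beta> \<phi>" and \<psi>: "rg_morphism \<Sigma> \<beta> \<Delta> \<alpha> \<psi>"
    and "\<And>v. v \<in> Obj \<Delta> \<Longrightarrow> on_obj \<psi> (on_obj \<phi> v) = v" and f: "f \<in> Mor \<Delta>"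
  shows "on_mor \<psi> (on_mor \<phi> f) = f"
proof -
  interpret p: k_graph_morphism \<Delta> \<Sigma> \<phi> using \<phi> by (simp add: rg_morphism_def)
  interpret q: k_graph_morphism \<Sigma> \<Delta> \<psi> using \<psi> by (simp add: rg_morphism_def)
  show ?thesis
    using assms by (intro out_unique[of _ "Src \<Delta> f"])
      (auto simp: out_of_def rg_morphism_def p.mor_in q.mor_in p.map_Src q.map_Src total.Src_in)
qed

lemma rg_isomorphicI:
  assumes "rep_k_graph \<Lambda> \<Delta> \<alpha>" "rg_irreducible \<Delta> \<alpha>" "rep_k_graph \<Lambda> \<Sigma> \<beta>" "rg_irreducible \<Sigma> \<beta>"
    and "\<And>u. u \<in> Obj \<Delta> \<Longrightarrow> \<exists>w\<in>Obj \<Sigma>. liftable \<Sigma> \<beta> w = liftable \<Delta> \<alpha> u"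
    and "\<And>w. w \<in> Obj \<Sigma> \<Longrightarrow> \<exists>u\<in>Obj \<Delta>. liftable \<Delta> \<alpha> u = liftable \<Sigma> \<beta> w"
  shows "rg_isomorphic \<Delta> \<alpha> \<Sigma> \<beta>"
proof -
  interpret D: rep_k_graph \<Lambda> \<Delta> \<alpha> by fact
  interpret S: rep_k_graph \<Lambda> \<Sigma> \<beta> by fact
  obtain F where F: "\<And>u. u \<in> Obj \<Delta> \<Longrightarrow> F u \<in> Obj \<Sigma> \<and> liftable \<Sigma> \<beta> (F u) = liftable \<Delta> \<alpha> u"
    using assms(5) by metis
  obtain G where G: "\<And>w. w \<in> Obj \<Sigma> \<Longrightarrow> G w \<in> Obj \<Delta> \<and> liftable \<Delta> \<alpha> (G w) = liftable \<Sigma> \<beta> w"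
    using assms(6) by metis
  have GF: "G (F u) = u" if "u \<in> Obj \<Delta>" for u
    using F[of u] G[of "F u"] that assms(2) by (auto simp: rg_irreducible_iff dest: inj_onD)
  have FG: "F (G w) = w" if "w \<in> Obj \<Sigma>" for w
    using G[of w] F[of "G w"] that assms(4) by (auto simp: rg_irreducible_iff dest: inj_onD)
  obtain \<phi> where \<phi>: "rg_morphism \<Delta> \<alpha> \<Sigma> \<beta> \<phi>" "on_obj \<phi> = F"
    using rg_morphism_of_vertex_map[OF assms(1,3,4) F] by blast
  obtain \<psi> where \<psi>: "rg_morphism \<Sigma> \<beta> \<Delta> \<alpha> \<psi>" "on_obj \<psi> = G"
    using rg_morphism_of_vertex_map[OF assms(3,1,2) G] by blast
  show ?thesis
    unfolding rg_isomorphic_def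
    using \<phi> \<psi> GF FG D.rg_morphism_retract[OF \<phi>(1) \<psi>(1)] S.rg_morphism_retract[OF \<psi>(1) \<phi>(1)]
    by (intro exI[of _ \<phi>] exI[of _ \<psi>]) auto
qed

section \<open>From morphisms to module homomorphisms\<close>

lemma lin_lin: "lin g (lin h x) = lin (\<lambda>b. lin g (h b)) x"
  by (simp add: lin_def[of h] lin_def[of "\<lambda>b. lin g (h b)"] lin_sum lin_smul)

lemma lin_single_id: "lin (\<lambda>b. Poly_Mapping.single b 1) x = x"
proof -
  have "lin (\<lambda>b. Poly_Mapping.single b 1) x =
      (\<Sum>b\<in>Poly_Mapping.keys x. Poly_Mapping.single b (Poly_Mapping.lookup x b))"
    unfolding lin_def by (intro sum.cong refl poly_mapping_eqI) (simp add: lookup_single when_def)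
  then show ?thesis by (simp flip: poly_mapping_expand)
qed

lemma rg_morphism_letter_lift:
  assumes "rep_k_graph \<Lambda> \<Delta> \<alpha>" "rep_k_graph \<Lambda> \<Sigma> \<beta>" and \<phi>: "rg_morphism \<Delta> \<alpha> \<Sigma> \<beta> \<phi>"
    and v: "v \<in> Obj \<Delta>"
  shows "letter_lift \<Sigma> \<beta> l (on_obj \<phi> v) w \<longleftrightarrow> (\<exists>x. letter_lift \<Delta> \<alpha> l v x \<and> on_obj \<phi> x = w)"
proof -
  interpret D: rep_k_graph \<Lambda> \<Delta> \<alpha> by fact
  interpret S: rep_k_graph \<Lambda> \<Sigma> \<beta> by fact
  interpret p: k_graph_morphism \<Delta> \<Sigma> \<phi> using \<phi> by (simp add: rg_morphism_def)
  have obj: "on_obj \<beta> (on_obj \<phi> v) = on_obj \<alpha> v"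
    and mor: "\<And>f. f \<in> Mor \<Delta> \<Longrightarrow> on_mor \<beta> (on_mor \<phi> f) = on_mor \<alpha> f"
    using \<phi> v by (auto simp: rg_morphism_def)
  have up: "letter_lift \<Sigma> \<beta> l (on_obj \<phi> v) (on_obj \<phi> x)" if "letter_lift \<Delta> \<alpha> l v x" for x
  proof (cases l)
    case (Arr f)
    with that obtain e where "e \<in> Mor \<Delta>" "on_mor \<alpha> e = f" "Src \<Delta> e = v" "Rng \<Delta> e = x"
      by (auto simp: D.letter_lift_Arr)
    then show ?thesis
      unfolding Arr S.letter_lift_Arr
      by (intro bexI[of _ "on_mor \<phi> e"]) (auto simp: p.map_Src p.map_Rng mor p.mor_in)
  next
    case (Star f)
    with that obtain e where "e \<in> Mor \<Delta>" "on_mor \<alpha> e = f" "Deg \<Lambda> f \<noteq> 0" "Rng \<Delta> e = v" "Src \<Delta> e = x"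
      by (auto simp: D.letter_lift_Star)
    then show ?thesis
      unfolding Star S.letter_lift_Star
      by (intro bexI[of _ "on_mor \<phi> e"]) (auto simp: p.map_Src p.map_Rng mor p.mor_in)
  qed
  have ex: "\<exists>x. letter_lift \<Delta> \<alpha> l v x" if lift: "letter_lift \<Sigma> \<beta> l (on_obj \<phi> v) w"
  proof (cases l)
    case (Arr f)
    with lift obtain g where g: "g \<in> Mor \<Sigma>" "on_mor \<beta> g = f" "Src \<Sigma> g = on_obj \<phi> v"
      by (auto simp: S.letter_lift_Arr)
    then have "Src \<Lambda> f = on_obj \<alpha> v" "f \<in> Mor \<Lambda>"
      using S.map_Src[of g] S.mor_in[of g] obj by auto
    then obtain e where "e \<in> out_of \<Delta> v" "on_mor \<alpha> e = f"
      using D.out_exists[OF v] by blast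
    then show ?thesis by (auto simp: Arr D.letter_lift_Arr out_of_def)
  next
    case (Star f)
    with lift obtain g where g: "g \<in> Mor \<Sigma>" "on_mor \<beta> g = f" "Rng \<Sigma> g = on_obj \<phi> v" "Deg \<Lambda> f \<noteq> 0"
      by (auto simp: S.letter_lift_Star)
    obtain e where "into_deg \<Delta> v (Deg \<Sigma> g) = {e}"
      using D.into_deg_singleton[OF v] by blast
    then have e: "e \<in> Mor \<Delta>" "Rng \<Delta> e = v" "Deg \<Delta> e = Deg \<Sigma> g"
      by (auto simp: into_deg_def into_def)
    then have "on_mor \<phi> e = g"
      using g by (intro S.into_unique[of _ "on_obj \<phi> v"])
        (auto simp: into_def p.mor_in p.map_Rng p.map_Deg)
    then have "on_mor \<alpha> e = f" using mor e(1) g(2) by metis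
    then show ?thesis using e g Star by (auto simp: D.letter_lift_Star)
  qed
  show ?thesis using up ex S.letter_lift_det by metis
qed

lemma rg_morphism_module_hom:
  fixes \<Delta> :: "('o, 'm, 'k::finite) kgraph"
  assumes "rep_k_graph \<Lambda> \<Delta> \<alpha>" "rep_k_graph \<Lambda> \<Sigma> \<beta>" and \<phi>: "rg_morphism \<Delta> \<alpha> \<Sigma> \<beta> \<phi>"
  shows "module_hom (KP TYPE('f::field) \<Lambda>) (rep_module \<Delta> \<alpha>) (rep_module \<Sigma> \<beta>)
    (lin (\<lambda>v. Poly_Mapping.single (on_obj \<phi> v) 1))"
proof -
  interpret D: rep_k_graph \<Lambda> \<Delta> \<alpha> by fact
  interpret S: rep_k_graph \<Lambda> \<Sigma> \<beta> by fact
  interpret p: k_graph_morphism \<Delta> \<Sigma> \<phi> using \<phi> by (simp add: rg_morphism_def)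
  let ?b = "\<lambda>v. Poly_Mapping.single (on_obj \<phi> v) 1 :: _ \<Rightarrow>\<^sub>0 'f"
  have keys: "Poly_Mapping.keys (lin ?b x) \<subseteq> Obj \<Sigma>" if "Poly_Mapping.keys x \<subseteq> Obj \<Delta>" for x
    using that p.obj_in by (intro lin_keys) auto
  have basis: "act_basis \<Sigma> \<beta> l (on_obj \<phi> v) = lin ?b (act_basis \<Delta> \<alpha> l v)"
    if v: "v \<in> Obj \<Delta>" and l: "l \<in> kp_letters \<Lambda>" for l v
  proof (cases "\<exists>x. letter_lift \<Delta> \<alpha> l v x")
    case True
    then obtain x where x: "letter_lift \<Delta> \<alpha> l v x" by blast
    then have "letter_lift \<Sigma> \<beta> l (on_obj \<phi> v) (on_obj \<phi> x)"
      using rg_morphism_letter_lift[OF assms v] by blast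
    with x show ?thesis by (simp add: D.act_basis_lift S.act_basis_lift lin_single)
  next
    case False
    moreover from this have "\<nexists>w. letter_lift \<Sigma> \<beta> l (on_obj \<phi> v) w"
      using rg_morphism_letter_lift[OF assms v] by blast
    ultimately show ?thesis by (simp add: D.act_basis_no_lift S.act_basis_no_lift l)
  qed
  have letter: "lin (act_basis \<Sigma> \<beta> l) (lin ?b x) = lin ?b (lin (act_basis \<Delta> \<alpha> l) x)"
    if "l \<in> kp_letters \<Lambda>" "Poly_Mapping.keys x \<subseteq> Obj \<Delta>" for l x
    unfolding lin_lin lin_single smul_one using that by (intro lin_cong basis) auto
  have word: "act_word \<Sigma> \<beta> (Word l) (lin ?b x) = lin ?b (act_word \<Delta> \<alpha> (Word l) x) \<and>
      Poly_Mapping.keys (act_word \<Delta> \<alpha> (Word l) x :: _ \<Rightarrow>\<^sub>0 'f) \<subseteq> Obj \<Delta>"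
    if "set l \<subseteq> kp_letters \<Lambda>" and x: "Poly_Mapping.keys x \<subseteq> Obj \<Delta>" for l x
    using that(1)
  proof (induction l)
    case (Cons g l)
    then show ?case
      using lin_keys[OF D.act_basis_keys] by (simp add: act_word_def letter)
  qed (use x in \<open>simp add: act_word_def\<close>)
  have free: "act_free \<Sigma> \<beta> a (lin ?b x) = lin ?b (act_free \<Delta> \<alpha> a x)"
    if a: "a \<in> free_algebra (kp_letters \<Lambda>)" and x: "Poly_Mapping.keys x \<subseteq> Obj \<Delta>" for a x
  proof -
    have "act_word \<Sigma> \<beta> w (lin ?b x) = lin ?b (act_word \<Delta> \<alpha> w x)" if "w \<in> Poly_Mapping.keys a" for w
      using that a word[of "letters w" x] x by (auto simp: free_algebra_def)
    then show ?thesis unfolding act_free_def lin_lin by (rule lin_cong)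
  qed
  show ?thesis
    unfolding module_hom_def
  proof (intro conjI ballI allI)
    fix X and x :: "'o \<Rightarrow>\<^sub>0 'f"
    assume X: "X \<in> acarrier (KP TYPE('f) \<Lambda>)" and x: "x \<in> mcarrier (rep_module \<Delta> \<alpha>)"
    from X obtain a where a: "a \<in> free_algebra (kp_letters \<Lambda>)"
        "X = coset_of (gen_ideal (kp_letters \<Lambda>) (kp_relators \<Lambda>)) a"
      by (auto simp: KP_def presented_carrier[OF D.base.relators_free])
    from x have "Poly_Mapping.keys x \<subseteq> Obj \<Delta>" by (simp add: rep_module_def)
    then show "lin ?b (mact (rep_module \<Delta> \<alpha>) X x) = mact (rep_module \<Sigma> \<beta>) X (lin ?b x)"
      using a keys free by (simp add: D.mact_rep_module S.mact_rep_module)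
  qed (use keys in \<open>auto simp: rep_module_def lin_add lin_smul\<close>)
qed

lemma rg_isomorphic_module_isomorphic:
  assumes "rep_k_graph \<Lambda> \<Delta> \<alpha>" "rep_k_graph \<Lambda> \<Sigma> \<beta>" "rg_isomorphic \<Delta> \<alpha> \<Sigma> \<beta>"
  shows "module_isomorphic (KP TYPE('f::field) \<Lambda>) (rep_module \<Delta> \<alpha>) (rep_module \<Sigma> \<beta>)"
proof -
  from assms(3) obtain \<phi> \<psi> where
    \<phi>: "rg_morphism \<Delta> \<alpha> \<Sigma> \<beta> \<phi>" and \<psi>: "rg_morphism \<Sigma> \<beta> \<Delta> \<alpha> \<psi>"
    and inv: "\<And>v. v \<in> Obj \<Delta> \<Longrightarrow> on_obj \<psi> (on_obj \<phi> v) = v"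
      "\<And>v. v \<in> Obj \<Sigma> \<Longrightarrow> on_obj \<phi> (on_obj \<psi> v) = v"
    unfolding rg_isomorphic_def by blast
  let ?h = "lin (\<lambda>v. Poly_Mapping.single (on_obj \<phi> v) 1) :: _ \<Rightarrow> (_ \<Rightarrow>\<^sub>0 'f)"
  let ?k = "lin (\<lambda>v. Poly_Mapping.single (on_obj \<psi> v) 1) :: _ \<Rightarrow> (_ \<Rightarrow>\<^sub>0 'f)"
  note h = rg_morphism_module_hom[OF assms(1,2) \<phi>, where 'f = 'f]
  note k = rg_morphism_module_hom[OF assms(2,1) \<psi>, where 'f = 'f]
  have kh: "?k (?h x) = x" if "Poly_Mapping.keys x \<subseteq> Obj \<Delta>" for x
  proof -
    have "?k (?h x) = lin (\<lambda>v. Poly_Mapping.single v 1) x"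
      unfolding lin_lin using that inv by (intro lin_cong) (auto simp: lin_single)
    then show ?thesis by (simp add: lin_single_id)
  qed
  have hk: "?h (?k x) = x" if "Poly_Mapping.keys x \<subseteq> Obj \<Sigma>" for x
  proof -
    have "?h (?k x) = lin (\<lambda>v. Poly_Mapping.single v 1) x"
      unfolding lin_lin using that inv by (intro lin_cong) (auto simp: lin_single)
    then show ?thesis by (simp add: lin_single_id)
  qed
  have "bij_betw ?h (mcarrier (rep_module \<Delta> \<alpha>)) (mcarrier (rep_module \<Sigma> \<beta>))"
    using h k kh hk by (intro bij_betw_byWitness[where f' = ?k])
      (auto simp: module_hom_def rep_module_def)
  with h show ?thesis unfolding module_isomorphic_def by blast
qed

theorem corollary30:
  fixes \<Lambda> :: "('p, 'q, 'k::finite) kgraph"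
    and \<Delta> :: "('o, 'm, 'k) kgraph" and \<alpha> :: "('o, 'm, 'p, 'q) kmap"
    and \<Sigma> :: "('s, 't, 'k) kgraph" and \<beta> :: "('s, 't, 'p, 'q) kmap"
  assumes "standing_k_graph \<Lambda>"
    and "rep_k_graph \<Lambda> \<Delta> \<alpha>" and "rg_irreducible \<Delta> \<alpha>"
    and "rep_k_graph \<Lambda> \<Sigma> \<beta>" and "rg_irreducible \<Sigma> \<beta>"
  shows "rg_isomorphic \<Delta> \<alpha> \<Sigma> \<beta> \<longleftrightarrow>
    module_isomorphic (KP TYPE('f::field) \<Lambda>) (rep_module \<Delta> \<alpha>) (rep_module \<Sigma> \<beta>)"
proof
  assume "rg_isomorphic \<Delta> \<alpha> \<Sigma> \<beta>"
  then show "module_isomorphic (KP TYPE('f::field) \<Lambda>) (rep_module \<Delta> \<alpha>) (rep_module \<Sigma> \<beta>)"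
    using assms by (intro rg_isomorphic_module_isomorphic)
next
  let ?M = "rep_module \<Delta> \<alpha> :: ('o \<Rightarrow>\<^sub>0 'f, 'f, _) lmod"
    and ?N = "rep_module \<Sigma> \<beta> :: ('s \<Rightarrow>\<^sub>0 'f, 'f, _) lmod"
  assume "module_isomorphic (KP TYPE('f::field) \<Lambda>) ?M ?N"
  then obtain h where hom: "module_hom (KP TYPE('f) \<Lambda>) ?M ?N h"
    and bij: "bij_betw h (mcarrier ?M) (mcarrier ?N)"
    unfolding module_isomorphic_def by blast
  let ?k = "inv_into (mcarrier ?M) h"
  have hom': "module_hom (KP TYPE('f) \<Lambda>) ?N ?M ?k"
    by (rule module_hom_inverse[OF rep_k_graph.left_module_rep_module[OF assms(2)] hom bij])
  have inj: "inj_on h (mcarrier ?M)" "inj_on ?k (mcarrier ?N)"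
    using bij bij_betw_inv_into[OF bij] by (auto simp: bij_betw_def)
  show "rg_isomorphic \<Delta> \<alpha> \<Sigma> \<beta>"
    using injective_hom_vertex[OF assms(2,4,5) hom inj(1)]
      injective_hom_vertex[OF assms(4,2,3) hom' inj(2)]
    by (intro rg_isomorphicI[OF assms(2-5)])
qed

end
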